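(* As formal power series in $q$ (equivalently, as analytic functions for $0<|q|<1$), \[ \sum_{n=0}^{\infty}\big(N(0,4;n)-N(2,4;n)\big)q^{n} = 2-2q^2g(-q^2;q^{16}) +2q^5g(-q^6;q^{16}) -\frac{J_{2,4}\overline{J}_{6,16}}{J_4}+q\,\frac{J_{2,4}\overline{J}_{2,16}}{J_4}. \]
   Context: Throughout, $q$ is a complex number with $0<|q|<1$. Write $(x)_n=(x;q)_n=\prod_{i=0}^{n-1}(1-q^ix)$ and $(x)_\infty=(x;q)_\infty=\prod_{i\ge0}(1-q^ix)$. Let $j(x;q)=(x)_\infty(q/x)_\infty(q)_\infty=\sum_{n\in\mathbb Z}(-1)^nq^{\binom n2}x^n$. For integers $a$ and $m\ge1$: $J_{a,m}=j(q^a;q^m)$, $\overline{J}_{a,m}=j(-q^a;q^m)$, and $J_m=J_{m,3m}=\prod_{i\ge1}(1-q^{mi})$. The universal mock theta function is $g(x;q)=x^{-1}\big(-1+\sum_{n\ge0}\frac{q^{n^2}}{(x)_{n+1}(q/x)_n}\big)$. Ranks: define integers $N(m,n)$ ($m\in\mathbb Z$, $n\ge0$) by $\sum_{n\ge0}\sum_{m\in\mathbb Z}N(m,n)z^mq^n=\sum_{n\ge0}\frac{q^{n^2}}{(zq)_n(z^{-1}q)_n}$; for $n\ge1$, $N(m,n)$ is the number of partitions of $n$ with rank (largest part minus number of parts) equal to $m$, and $N(m,0)=\delta_{m,0}$. For $M\ge1$ and an integer $a$, $N(a,M;n)=\sum_{m\equiv a \pmod M}N(m,n)$. *)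

theory Defs
  imports "HOL-Analysis.Analysis" "HOL-Library.Multiset"
begin

definition qpoch :: "complex \<Rightarrow> complex \<Rightarrow> nat \<Rightarrow> complex" where
  "qpoch x q n = (\<Prod>i<n. 1 - q ^ i * x)"

definition qpoch_inf :: "complex \<Rightarrow> complex \<Rightarrow> complex" where
  "qpoch_inf x q = (\<Prod>i. 1 - q ^ i * x)"

definition jfun :: "complex \<Rightarrow> complex \<Rightarrow> complex" where
  "jfun x q = qpoch_inf x q * qpoch_inf (q / x) q * qpoch_inf q q"

definition Jam :: "int \<Rightarrow> nat \<Rightarrow> complex \<Rightarrow> complex" where
  "Jam a m q = jfun (q powi a) (q ^ m)"

definition Jbar :: "int \<Rightarrow> nat \<Rightarrow> complex \<Rightarrow> complex" where
  "Jbar a m q = jfun (- (q powi a)) (q ^ m)"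

definition Jm :: "nat \<Rightarrow> complex \<Rightarrow> complex" where
  "Jm m q = Jam (int m) (3 * m) q"

definition gmock :: "complex \<Rightarrow> complex \<Rightarrow> complex" where
  "gmock x q = inverse x *
     (-1 + (\<Sum>n. q ^ (n\<^sup>2) / (qpoch x q (Suc n) * qpoch (q / x) q n)))"

definition partitions_of :: "nat \<Rightarrow> nat multiset set" where
  "partitions_of n = {P. (\<forall>x\<in>#P. 0 < x) \<and> sum_mset P = n}"

definition prank :: "nat multiset \<Rightarrow> int" where
  "prank P = (if P = {#} then 0 else int (Max_mset P)) - int (size P)"

definition Nrank :: "int \<Rightarrow> nat \<Rightarrow> nat" where
  "Nrank m n = card {P \<in> partitions_of n. prank P = m}"

text \<open>N(a,M;n) = sum over m congruent to a mod M of N(m,n); only ranks in [-n,n] occur.\<close>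
definition Nmod :: "int \<Rightarrow> int \<Rightarrow> nat \<Rightarrow> nat" where
  "Nmod a M n = (\<Sum>m \<in> {m \<in> {- int n .. int n}. m mod M = a mod M}. Nrank m n)"

end

theory Submission
  imports Defs "HOL-Complex_Analysis.Complex_Analysis"
begin

text \<open>
  Write $\theta(z;q) = (z)_\infty (q/z)_\infty$ and $P(z;q) = 1 + z\,g(z;q)$. Weighting partitions by
  $z^{\mathrm{rank}}$ and sorting by largest part, Rogers--Fine gives the rank series $(1-z)P(z;q)$;
  at $z = \pm i$ it is the left-hand side, since $i^m + (-i)^m$ is $2, 0, -2, 0$ for $m \equiv 0, 1, 2, 3$ modulo 4.
  The function $P$ satisfies $P(qz;q) = 1 - qz^2 - qz^3 P(z;q)$, and $\theta P$ is holomorphic on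
  the punctured plane. Hence, for
  \[ \tfrac12(P(z;q) - P(-z;q)) - z^{-1}(P(-qz^2;q^4) - 1), \]
  the product with $\theta(z;q)\,\theta(-z;q)\,\theta(-qz^2;q^4)/z$ is holomorphic and invariant under
  $z \mapsto q^2 z$, so it is a constant, which is read off at $z = 1$.
  Taking $z = i$ in base $q$ expresses the left-hand side by $P(q;q^4)$; taking $z = q$ and $z = q^5$ in base $q^4$
  expresses $P(q;q^4)$ by $P(-q^2;q^{16})$ and $P(-q^6;q^{16})$. The remaining theta quotients combine by
  $j(x;q) = j(-qx^2;q^4) - x\,j(-q^3x^2;q^4)$ and a formula for $j(x;q)^2 + j(-x;q)^2$.
\<close>

section \<open>Infinite products\<close>

text \<open>The substitution -q z^2 in base q^4 is chosen to match inhomogeneous terms. Two steps of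
  the shift equation multiply the odd part of P(z;q) by q^5 z^6 and add -q^4 z^3 + q^5 z^5. With w =
  -q z^2, the replacement of z by q^2 z is the single step from w to q^4 w, and z^(-1) (P(w;q^4) -
  1) then picks up the same factor and the same added terms. So the difference obeys a homogeneous
  equation, and the theta factors supply the opposite multiplier. An odd part alone does not
  determine a value. At z = i this is repaired by the symmetry of the rank series under z -> 1/z,
  which makes its values at i and -i equal. In base q^4 it is repaired by the odd factor z^3 in the
  shift equation: the odd part at q^4 z carries the even part at z. Hence z = q and z = q^5 give the
  difference and the sum of P(q;q^4) and P(-q;q^4), and adding them removes P(-q;q^4). The obstacle
  is that P has poles, one of them at the base point 1. Therefore P is replaced by theta times P,
  called \<open>unisum\<close>, which has a finite value at 1.\<close>

lemma qpoch_Suc: "qpoch x q (Suc n) = qpoch x q n * (1 - q ^ n * x)"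
  by (simp add: qpoch_def)

lemma qpoch_0 [simp]: "qpoch x q 0 = 1"
  by (simp add: qpoch_def)

lemma qpoch_Suc': "qpoch x q (Suc n) = (1 - x) * qpoch (q * x) q n"
  unfolding qpoch_def by (subst prod.lessThan_Suc_shift) (simp add: mult_ac)

lemma summable_qpoch_factors:
  assumes "norm (q :: complex) < 1"
  shows "summable (\<lambda>i. norm (1 - q ^ i * x - 1))"
proof -
  have "summable (\<lambda>i. norm x * norm q ^ i)"
    using assms by (intro summable_mult summable_geometric) simp
  then show ?thesis by (simp add: norm_mult norm_power mult.commute)
qed

lemma convergent_prod_qpoch:
  assumes "norm (q :: complex) < 1"
  shows "convergent_prod (\<lambda>i. 1 - q ^ i * x)"
  using summable_qpoch_factors[OF assms]
  by (intro abs_convergent_prod_imp_convergent_prod summable_imp_abs_convergent_prod)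

lemma qpoch_tendsto:
  assumes "norm (q :: complex) < 1"
  shows "(\<lambda>n. qpoch x q n) \<longlonglongrightarrow> qpoch_inf x q"
proof -
  have "(\<lambda>n. \<Prod>i\<le>n. 1 - q ^ i * x) \<longlonglongrightarrow> qpoch_inf x q"
    unfolding qpoch_inf_def by (rule convergent_prod_LIMSEQ[OF convergent_prod_qpoch[OF assms]])
  then have "(\<lambda>n. qpoch x q (Suc n)) \<longlonglongrightarrow> qpoch_inf x q"
    by (simp add: qpoch_def lessThan_Suc_atMost)
  then show ?thesis by (simp only: filterlim_sequentially_Suc)
qed

lemma qpoch_inf_rec:
  assumes "norm (q :: complex) < 1"
  shows "qpoch_inf x q = (1 - x) * qpoch_inf (q * x) q"
proof -
  have "(\<lambda>n. (1 - x) * qpoch (q * x) q n) \<longlonglongrightarrow> (1 - x) * qpoch_inf (q * x) q"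
    by (intro tendsto_intros qpoch_tendsto assms)
  moreover have "(\<lambda>n. qpoch x q (Suc n)) \<longlonglongrightarrow> qpoch_inf x q"
    using qpoch_tendsto[OF assms] by (simp only: filterlim_sequentially_Suc)
  ultimately show ?thesis
    unfolding qpoch_Suc' using LIMSEQ_unique by blast
qed

lemma qpoch_inf_split:
  assumes "norm (q :: complex) < 1"
  shows "qpoch_inf x q = qpoch x q n * qpoch_inf (q ^ n * x) q"
proof (induction n)
  case (Suc n)
  then show ?case
    using qpoch_inf_rec[OF assms, of "q ^ n * x"] by (simp add: qpoch_Suc mult_ac)
qed simp

lemma qpoch_inf_eq_0_iff:
  assumes "norm (q :: complex) < 1"
  shows "qpoch_inf x q = 0 \<longleftrightarrow> (\<exists>n. q ^ n * x = 1)"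
proof -
  have "(\<lambda>i. 1 - q ^ i * x) has_prod qpoch_inf x q"
    unfolding qpoch_inf_def by (intro convergent_prod_has_prod convergent_prod_qpoch assms)
  then show ?thesis using has_prod_eq_0_iff by (force simp: image_iff)
qed

lemma qpoch_inf_nonzero:
  assumes "norm (q :: complex) < 1" "norm x < 1"
  shows "qpoch_inf x q \<noteq> 0"
proof
  assume "qpoch_inf x q = 0"
  then obtain n where n: "q ^ n * x = 1" using qpoch_inf_eq_0_iff[OF assms(1)] by auto
  have "norm (q ^ n * x) < 1"
    using mult_left_le_one_le[of "norm x" "norm q ^ n"] assms
    by (simp add: norm_mult norm_power power_le_one le_less_trans)
  then show False using n by simp
qed

lemma qpoch_inf_0 [simp]: "qpoch_inf 0 q = 1"
  by (simp add: qpoch_inf_def)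

lemma qpoch_add: "qpoch x q (m + n) = qpoch x q m * qpoch (q ^ m * x) q n"
  by (induction n) (simp_all add: qpoch_Suc power_add mult_ac)

text \<open>Sorting the exponents by residue modulo \<open>m\<close> is exact for the first
  \<open>m * n\<close> factors; the infinite products follow along this subsequence.\<close>

lemma qpoch_inf_power_base:
  assumes "norm (q :: complex) < 1" and "m > 0"
  shows "(\<Prod>j<m. qpoch_inf (q ^ j * x) (q ^ m)) = qpoch_inf x q"
proof -
  have qm: "norm (q ^ m) < 1" using assms by (simp add: norm_power power_less_one_iff)
  have *: "qpoch x q (m * n) = (\<Prod>j<m. qpoch (q ^ j * x) (q ^ m) n)" for n
  proof (induction n)
    case (Suc n)
    have "qpoch x q (m * Suc n) = qpoch x q (m * n) * qpoch (q ^ (m * n) * x) q m"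
      using qpoch_add[of x q "m * n" m] by (simp add: add.commute)
    also have "qpoch (q ^ (m * n) * x) q m = (\<Prod>j<m. 1 - (q ^ m) ^ n * (q ^ j * x))"
      by (simp add: qpoch_def power_mult mult_ac)
    finally show ?case by (simp add: Suc qpoch_Suc prod.distrib)
  qed simp
  have "(\<lambda>n. \<Prod>j<m. qpoch (q ^ j * x) (q ^ m) n) \<longlonglongrightarrow> (\<Prod>j<m. qpoch_inf (q ^ j * x) (q ^ m))"
    by (intro tendsto_prod qpoch_tendsto qm)
  moreover have "(\<lambda>n. qpoch x q (m * n)) \<longlonglongrightarrow> qpoch_inf x q"
    using LIMSEQ_subseq_LIMSEQ[OF qpoch_tendsto[OF assms(1), of x], of "\<lambda>n. m * n"] assms(2)
    by (simp add: strict_mono_def comp_def)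
  ultimately show ?thesis unfolding * by (rule LIMSEQ_unique)
qed

lemma qpoch_inf_square_base:
  assumes "norm (q :: complex) < 1"
  shows "qpoch_inf x (q\<^sup>2) * qpoch_inf (q * x) (q\<^sup>2) = qpoch_inf x q"
  using qpoch_inf_power_base[OF assms, of 2 x] by (simp add: numeral_2_eq_2)

lemma qpoch_inf_mult_minus:
  assumes "norm (q :: complex) < 1"
  shows "qpoch_inf x q * qpoch_inf (- x) q = qpoch_inf (x\<^sup>2) (q\<^sup>2)"
proof -
  have q2: "norm (q\<^sup>2) < 1" using assms by (simp add: norm_power power_less_one_iff)
  have "qpoch x q n * qpoch (- x) q n = qpoch (x\<^sup>2) (q\<^sup>2) n" for n
  proof -
    have "(1 - q ^ i * x) * (1 - q ^ i * - x) = 1 - (q\<^sup>2) ^ i * x\<^sup>2" for i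
      by (simp add: algebra_simps power2_eq_square power_mult_distrib)
    then show ?thesis by (simp add: qpoch_def flip: prod.distrib)
  qed
  moreover have "(\<lambda>n. qpoch x q n * qpoch (- x) q n) \<longlonglongrightarrow> qpoch_inf x q * qpoch_inf (- x) q"
    by (intro tendsto_mult qpoch_tendsto assms)
  ultimately have "(\<lambda>n. qpoch (x\<^sup>2) (q\<^sup>2) n) \<longlonglongrightarrow> qpoch_inf x q * qpoch_inf (- x) q"
    by simp
  then show ?thesis using qpoch_tendsto[OF q2] LIMSEQ_unique by blast
qed

text \<open>From 1 + t <= exp t and a geometric series. The bound is independent of \<open>n\<close>
  and increases with \<open>norm x\<close>, so it passes to the infinite product and later supplies
  the majorants for \<open>unisum\<close>.\<close>

lemma norm_qpoch_le:
  assumes "norm (q :: complex) < 1"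
  shows "norm (qpoch x q n) \<le> exp (norm x / (1 - norm q))"
proof -
  have "norm (qpoch x q n) \<le> (\<Prod>i<n. 1 + norm q ^ i * norm x)"
    unfolding qpoch_def prod_norm[symmetric]
  proof (intro prod_mono conjI)
    fix i
    show "norm (1 - q ^ i * x) \<le> 1 + norm q ^ i * norm x"
      using norm_triangle_ineq4[of 1 "q ^ i * x"] by (simp add: norm_mult norm_power)
  qed simp
  also have "\<dots> \<le> exp (\<Sum>i<n. norm q ^ i * norm x)"
    by (rule prod_le_exp_sum) simp
  also have "(\<Sum>i<n. norm q ^ i * norm x) = (\<Sum>i<n. norm q ^ i) * norm x"
    by (simp add: sum_distrib_right)
  also have "exp ((\<Sum>i<n. norm q ^ i) * norm x) \<le> exp ((1 / (1 - norm q)) * norm x)"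
  proof -
    have "(\<Sum>i<n. norm q ^ i) \<le> (\<Sum>i. norm q ^ i)"
      using assms by (intro sum_le_suminf summable_geometric) auto
    then have "(\<Sum>i<n. norm q ^ i) \<le> 1 / (1 - norm q)"
      using assms by (simp add: suminf_geometric)
    then show ?thesis by (subst exp_le_cancel_iff) (rule mult_right_mono, auto)
  qed
  finally show ?thesis by simp
qed

lemma norm_qpoch_inf_le:
  assumes "norm (q :: complex) < 1"
  shows "norm (qpoch_inf x q) \<le> exp (norm x / (1 - norm q))"
  by (rule LIMSEQ_le_const2[OF tendsto_norm[OF qpoch_tendsto[OF assms]]])
     (use norm_qpoch_le[OF assms] in auto)

lemma holomorphic_qpoch_inf:
  assumes "norm (q :: complex) < 1"
  shows "(\<lambda>x. qpoch_inf x q) holomorphic_on A"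
proof -
  have "(\<lambda>x. qpoch_inf x q) holomorphic_on UNIV"
  proof (rule holomorphic_uniform_sequence)
    show "(\<lambda>x. qpoch x q n) holomorphic_on UNIV" for n
      unfolding qpoch_def by (intro holomorphic_intros)
    fix x :: complex
    have "uniformly_convergent_on (cball x 1) (\<lambda>N y. \<Prod>n<N. 1 - q ^ n * y)"
    proof (rule uniformly_convergent_on_prod')
      show "uniformly_convergent_on (cball x 1) (\<lambda>N y. \<Sum>n<N. norm (1 - q ^ n * y - 1))"
      proof (rule Weierstrass_m_test'[where M = "\<lambda>n. (norm x + 1) * norm q ^ n"])
        fix n y assume "y \<in> cball x 1"
        then have "norm y \<le> norm x + 1"
          using norm_triangle_ineq2[of y x] by (simp add: dist_norm norm_minus_commute)
        then show "norm (norm (1 - q ^ n * y - 1)) \<le> (norm x + 1) * norm q ^ n"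
          by (simp add: norm_mult norm_power mult.commute mult_right_mono)
      next
        show "summable (\<lambda>n. (norm x + 1) * norm q ^ n)"
          using assms by (intro summable_mult summable_geometric) simp
      qed
    qed (auto intro!: continuous_intros)
    then obtain l where l: "uniform_limit (cball x 1) (\<lambda>N y. qpoch y q N) l sequentially"
      by (auto simp: uniformly_convergent_on_def qpoch_def)
    have "l y = qpoch_inf y q" if "y \<in> cball x 1" for y
      using tendsto_uniform_limitI[OF l that] qpoch_tendsto[OF assms] LIMSEQ_unique by blast
    then have "uniform_limit (cball x 1) (\<lambda>N y. qpoch y q N) (\<lambda>y. qpoch_inf y q) sequentially"
      using l by (subst uniform_limit_cong'[where g = "\<lambda>N y. qpoch y q N" and i = l]) auto
    then show "\<exists>d. 0 < d \<and> cball x d \<subseteq> UNIV \<and>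
        uniform_limit (cball x d) (\<lambda>n x. qpoch x q n) (\<lambda>x. qpoch_inf x q) sequentially"
      by (intro exI[of _ 1]) auto
  qed auto
  then show ?thesis using holomorphic_on_subset by blast
qed

lemma holomorphic_qpoch_inf' [holomorphic_intros]:
  assumes "norm (q :: complex) < 1" "f holomorphic_on A"
  shows "(\<lambda>x. qpoch_inf (f x) q) holomorphic_on A"
  using holomorphic_on_compose_gen[OF assms(2) holomorphic_qpoch_inf[OF assms(1), of UNIV]]
  by (simp add: comp_def)

section \<open>The universal mock theta series\<close>

definition theta :: "complex \<Rightarrow> complex \<Rightarrow> complex" where
  "theta z q = qpoch_inf z q * qpoch_inf (q / z) q"

lemma jfun_theta: "jfun z q = theta z q * qpoch_inf q q"
  by (simp add: jfun_def theta_def)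

lemma theta_1 [simp]: "norm q < 1 \<Longrightarrow> theta 1 q = 0"
  using qpoch_inf_rec[of q 1] by (simp add: theta_def)

lemma theta_shift:
  assumes "norm q < 1" "q \<noteq> 0" "z \<noteq> 0"
  shows "theta (q * z) q = - theta z q / z"
proof -
  have "theta (q * z) q = qpoch_inf (q * z) q * ((1 - 1 / z) * qpoch_inf (q / z) q)"
    using qpoch_inf_rec[OF assms(1), of "1 / z"] assms by (simp add: theta_def)
  moreover have "theta z q = (1 - z) * qpoch_inf (q * z) q * qpoch_inf (q / z) q"
    using qpoch_inf_rec[OF assms(1), of z] by (simp add: theta_def)
  ultimately show ?thesis using assms(3) by (simp add: divide_simps) (simp add: algebra_simps)
qed

lemma theta_inverse:
  assumes "norm q < 1" "q \<noteq> 0" "z \<noteq> 0"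
  shows "theta (1 / z) q = - theta z q / z"
  using theta_shift[OF assms] assms by (simp add: theta_def mult.commute)

lemma theta_reflect:
  assumes "q \<noteq> 0" "z \<noteq> 0"
  shows "theta (q / z) q = theta z q"
  using assms by (simp add: theta_def mult.commute)

lemma theta_mult_minus:
  assumes "norm q < 1"
  shows "theta z q * theta (- z) q = theta (z\<^sup>2) (q\<^sup>2)"
  by (simp add: theta_def power_divide
      flip: qpoch_inf_mult_minus[OF assms, of z] qpoch_inf_mult_minus[OF assms, of "q / z", unfolded power_divide])

text \<open>The zeros of theta are the integer powers of \<open>q\<close>, and 1 is the only one of
  them in this annulus.\<close>

lemma theta_nonzero:
  assumes "norm q < 1" "norm q < norm z" "norm z * norm q < 1" "z \<noteq> 1"
  shows "theta z q \<noteq> 0"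
proof -
  have "q ^ n * z \<noteq> 1" for n
  proof (cases n)
    case (Suc m)
    have "norm (q ^ n * z) = norm q ^ m * (norm z * norm q)"
      by (simp add: Suc norm_mult norm_power)
    also have "\<dots> \<le> 1 * (norm z * norm q)"
      using assms by (intro mult_right_mono power_le_one) auto
    finally show ?thesis using assms(3) by auto
  qed (use assms in simp)
  then have "qpoch_inf z q \<noteq> 0" using qpoch_inf_eq_0_iff[OF assms(1)] by auto
  moreover have "qpoch_inf (q / z) q \<noteq> 0"
  proof (rule qpoch_inf_nonzero[OF assms(1)])
    have "norm z > 0" using assms(2) by (meson le_less_trans norm_ge_zero)
    then show "norm (q / z) < 1" using assms(2) by (simp add: norm_divide)
  qed
  ultimately show ?thesis by (simp add: theta_def)
qed

lemma holomorphic_theta [holomorphic_intros]: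
  assumes "norm q < 1" "f holomorphic_on A" "\<And>x. x \<in> A \<Longrightarrow> f x \<noteq> 0"
  shows "(\<lambda>x. theta (f x) q) holomorphic_on A"
  unfolding theta_def by (intro holomorphic_intros assms)

text \<open>The summand of P(z;q) multiplied by \<open>theta z q\<close>: the quotients (z)_inf /
  (z)_(n+1) and (q/z)_inf / (q/z)_n are again infinite products. No denominator is left, and the
  symmetry between \<open>z\<close> and \<open>1 / z\<close> becomes visible.\<close>

definition unisum_term :: "complex \<Rightarrow> complex \<Rightarrow> nat \<Rightarrow> complex" where
  "unisum_term z q n = q ^ n\<^sup>2 * qpoch_inf (q ^ Suc n * z) q * qpoch_inf (q ^ Suc n / z) q"

definition unisum :: "complex \<Rightarrow> complex \<Rightarrow> complex" where
  "unisum z q = (\<Sum>n. unisum_term z q n)"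

lemma norm_power_square_le:
  assumes "norm (q :: complex) < 1"
  shows "norm q ^ n\<^sup>2 \<le> norm q ^ n"
  using assms by (intro power_decreasing) (auto simp: power2_eq_square)

text \<open>Separate bounds for \<open>z\<close> and \<open>1 / z\<close> make the estimate uniform
  on discs that stay away from 0, as the Weierstrass test requires.\<close>

lemma norm_unisum_term_le:
  assumes q: "norm q < 1" and "norm z \<le> r" "norm (1 / z) \<le> s"
  shows "norm (unisum_term z q n) \<le> exp (r / (1 - norm q)) * exp (s / (1 - norm q)) * norm q ^ n"
proof -
  have *: "norm (qpoch_inf (q ^ Suc n * x) q) \<le> exp (c / (1 - norm q))" if "norm x \<le> c" for x c
  proof -
    have "norm (q ^ Suc n * x) \<le> 1 * c"
      unfolding norm_mult norm_power using q that by (intro mult_mono power_le_one) auto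
    then have "norm (q ^ Suc n * x) / (1 - norm q) \<le> c / (1 - norm q)"
      using q by (intro divide_right_mono) auto
    then show ?thesis using norm_qpoch_inf_le[OF q, of "q ^ Suc n * x"] 
      by (meson exp_le_cancel_iff order_trans)
  qed
  have "norm (unisum_term z q n) = norm q ^ n\<^sup>2 *
      norm (qpoch_inf (q ^ Suc n * z) q) * norm (qpoch_inf (q ^ Suc n * (1 / z)) q)"
    by (simp add: unisum_term_def norm_mult norm_power)
  also have "\<dots> \<le> norm q ^ n * exp (r / (1 - norm q)) * exp (s / (1 - norm q))"
    using assms by (intro mult_mono * norm_power_square_le) auto
  finally show ?thesis by (simp add: mult_ac)
qed

lemma summable_unisum_term:
  assumes "norm q < 1"
  shows "summable (unisum_term z q)"
  by (rule summable_comparison_test'[where N = 0, OF _ norm_unisum_term_le[OF assms order_refl order_refl]])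
     (use assms in \<open>intro summable_mult summable_geometric, simp\<close>)

lemma holomorphic_unisum:
  assumes "norm q < 1"
  shows "(\<lambda>z. unisum z q) holomorphic_on - {0}"
proof (rule holomorphic_uniform_sequence)
  show "open (- {0 :: complex})" by auto
  show "(\<lambda>z. \<Sum>i<n. unisum_term z q i) holomorphic_on - {0}" for n
    unfolding unisum_term_def by (intro holomorphic_intros assms) auto
  fix z :: complex assume "z \<in> - {0}"
  then have z: "norm z > 0" by simp
  have *: "norm x \<le> 3/2 * norm z \<and> norm x \<ge> norm z / 2" if "x \<in> cball z (norm z / 2)" for x
    using that norm_triangle_ineq2[of z x] norm_triangle_ineq2[of x z]
    by (simp add: dist_norm norm_minus_commute)
  have "uniform_limit (cball z (norm z / 2)) (\<lambda>n z. \<Sum>i<n. unisum_term z q i)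
          (\<lambda>z. \<Sum>i. unisum_term z q i) sequentially"
  proof (rule Weierstrass_m_test)
    fix n x assume "x \<in> cball z (norm z / 2)"
    with * have x: "norm x \<le> 3/2 * norm z" "norm x \<ge> norm z / 2" by auto
    have "norm (1 / x) \<le> 1 / (norm z / 2)"
      unfolding norm_divide norm_one using x z by (intro divide_left_mono mult_pos_pos) auto
    then show "norm (unisum_term x q n) \<le> exp ((3/2 * norm z) / (1 - norm q)) *
        exp ((1 / (norm z / 2)) / (1 - norm q)) * norm q ^ n"
      using x by (intro norm_unisum_term_le assms)
  next
    show "summable (\<lambda>n. exp ((3/2 * norm z) / (1 - norm q)) *
        exp ((1 / (norm z / 2)) / (1 - norm q)) * norm q ^ n)"
      using assms by (intro summable_mult summable_geometric) simp
  qed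
  moreover have "cball z (norm z / 2) \<subseteq> - {0}" using *[of 0] z by auto
  ultimately show "\<exists>d>0. cball z d \<subseteq> - {0} \<and>
      uniform_limit (cball z d) (\<lambda>n z. \<Sum>i<n. unisum_term z q i) (\<lambda>z. unisum z q) sequentially"
    using z unfolding unisum_def by (intro exI[of _ "norm z / 2"]) auto
qed

lemma holomorphic_unisum' [holomorphic_intros]:
  assumes "norm q < 1" "f holomorphic_on A" "\<And>x. x \<in> A \<Longrightarrow> f x \<noteq> 0"
  shows "(\<lambda>x. unisum (f x) q) holomorphic_on A"
proof -
  have "f ` A \<subseteq> - {0}" using assms(3) by auto
  then show ?thesis
    using holomorphic_on_compose_gen[OF assms(2) holomorphic_unisum[OF assms(1)]]
    by (simp add: comp_def)
qed

lemma unisum_inverse: "unisum (1 / z) q = unisum z q"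
  by (simp add: unisum_def unisum_term_def mult_ac)

text \<open>Division by \<open>theta_shift\<close> gives the shift equation of P; in this multiplied
  form it holds at the zeros of theta as well.\<close>

lemma unisum_shift:
  assumes q: "norm q < 1" "q \<noteq> 0" and z: "z \<noteq> 0"
  shows "unisum (q * z) q = q * z\<^sup>2 * unisum z q - (1 - q * z\<^sup>2) / z * theta z q"
proof -
  \<comment> \<open>\<open>unisum (q * z) q - q * z\<^sup>2 * unisum z q\<close> telescopes termwise, with \<open>W n - W (Suc n)\<close> as \<open>n\<close>-th term\<close>
  define W where "W n = (1 - q * z\<^sup>2) * (q ^ n\<^sup>2 * qpoch_inf (q ^ n * (q * z)) q * qpoch_inf (q ^ n * (1 / z)) q)" for n
  have W0: "W 0 = (1 - q * z\<^sup>2) * (- theta z q / z)"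
    using theta_shift[OF q z] z q by (simp add: W_def theta_def)
  have "W n - W (Suc n) = unisum_term (q * z) q n - q * z\<^sup>2 * unisum_term z q n" for n
  proof -
    define A B where "A = qpoch_inf (q ^ n * (q * (q * z))) q" and "B = qpoch_inf (q ^ n * (q / z)) q"
    have A: "qpoch_inf (q ^ n * (q * z)) q = (1 - q ^ n * (q * z)) * A"
      using qpoch_inf_rec[OF q(1), of "q ^ n * (q * z)"] by (simp add: A_def mult_ac)
    have B: "qpoch_inf (q ^ n * (1 / z)) q = (1 - q ^ n * (1 / z)) * B"
      using qpoch_inf_rec[OF q(1), of "q ^ n * (1 / z)"] by (simp add: B_def mult_ac)
    define N where "N = q ^ n"
    define M where "M = q ^ n\<^sup>2"
    have sq: "q ^ (Suc n)\<^sup>2 = M * N * N * q"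
      by (simp add: M_def N_def power2_eq_square power_add mult_ac)
    have "W n = (1 - q * z\<^sup>2) * (M * ((1 - N * (q * z)) * A) * ((1 - N / z) * B))"
      unfolding W_def A B by (simp add: N_def M_def)
    moreover have "W (Suc n) = (1 - q * z\<^sup>2) * ((M * N * N * q) * A * B)"
      unfolding W_def sq by (simp add: A_def B_def mult_ac)
    moreover have "unisum_term (q * z) q n = M * A * ((1 - N / z) * B)"
      using B q by (simp add: unisum_term_def A_def M_def N_def mult_ac)
    moreover have "unisum_term z q n = M * ((1 - N * (q * z)) * A) * B"
      using A by (simp add: unisum_term_def B_def M_def N_def mult_ac)
    \<comment> \<open>Once the common factor \<open>M * A * B\<close> is taken out, the telescoping
      is this identity, in which the terms quadratic in \<open>N\<close> cancel.\<close>
    moreover have "(1 - q * z\<^sup>2) * ((1 - N * (q * z)) * (1 - N / z)) - (1 - q * z\<^sup>2) * (N * N * q) =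
        (1 - N / z) - q * z\<^sup>2 * (1 - N * (q * z))"
      using z by (simp add: field_simps power2_eq_square)
    then have "((1 - q * z\<^sup>2) * ((1 - N * (q * z)) * (1 - N / z)) - (1 - q * z\<^sup>2) * (N * N * q)) * (M * A * B) =
        ((1 - N / z) - q * z\<^sup>2 * (1 - N * (q * z))) * (M * A * B)" by simp
    ultimately show ?thesis by (simp only:) (simp only: algebra_simps)
  qed
  moreover have "(\<lambda>n. W n - W (Suc n)) sums (W 0 - 0)"
  proof (rule telescope_sums')
    have q0: "(\<lambda>n. q ^ n) \<longlonglongrightarrow> 0" using q(1) by (rule LIMSEQ_power_zero)
    have "norm (q ^ n\<^sup>2) \<le> norm (q ^ n)" for n
      unfolding norm_power by (rule norm_power_square_le[OF q(1)])
    then have sq0: "(\<lambda>n. q ^ n\<^sup>2) \<longlonglongrightarrow> 0"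
      by (intro Lim_null_comparison[OF _ tendsto_norm_zero[OF q0]] always_eventually allI)
    have "isCont (\<lambda>x. qpoch_inf x q) y" for y
      using holomorphic_on_imp_continuous_on[OF holomorphic_qpoch_inf[OF q(1), of UNIV]]
      by (simp add: continuous_on_eq_continuous_at)
    then have "(\<lambda>n. qpoch_inf (q ^ n * c) q) \<longlonglongrightarrow> qpoch_inf (0 * c) q" for c
      by (rule isCont_tendsto_compose) (intro tendsto_intros q0)
    then have "(\<lambda>n. (1 - q * z\<^sup>2) * (q ^ n\<^sup>2 * qpoch_inf (q ^ n * (q * z)) q * qpoch_inf (q ^ n * (1 / z)) q))
        \<longlonglongrightarrow> (1 - q * z\<^sup>2) * (0 * qpoch_inf (0 * (q * z)) q * qpoch_inf (0 * (1 / z)) q)"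
      by (intro tendsto_mult tendsto_const sq0)
    then show "W \<longlonglongrightarrow> 0" unfolding W_def[abs_def] by simp
  qed
  ultimately have "(\<lambda>n. unisum_term (q * z) q n - q * z\<^sup>2 * unisum_term z q n) sums W 0" by simp
  moreover have "(\<lambda>n. unisum_term (q * z) q n - q * z\<^sup>2 * unisum_term z q n) sums
      (unisum (q * z) q - q * z\<^sup>2 * unisum z q)"
    unfolding unisum_def using summable_unisum_term[OF q(1)]
    by (intro sums_diff sums_mult summable_sums)
  ultimately have "unisum (q * z) q - q * z\<^sup>2 * unisum z q = W 0" by (rule sums_unique2[rotated])
  then show ?thesis unfolding W0 by (simp add: algebra_simps diff_divide_distrib)
qed

lemma universal_series_sums:
  assumes "norm q < 1" "theta x q \<noteq> 0"
  shows "(\<lambda>n. q ^ n\<^sup>2 / (qpoch x q (Suc n) * qpoch (q / x) q n)) sums (unisum x q / theta x q)"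
proof -
  have "unisum_term x q n / theta x q = q ^ n\<^sup>2 / (qpoch x q (Suc n) * qpoch (q / x) q n)" for n
  proof -
    have 1: "qpoch_inf x q = qpoch x q (Suc n) * qpoch_inf (q ^ Suc n * x) q"
      and 2: "qpoch_inf (q / x) q = qpoch (q / x) q n * qpoch_inf (q ^ Suc n / x) q"
      using qpoch_inf_split[OF assms(1), of x "Suc n"] qpoch_inf_split[OF assms(1), of "q / x" n]
      by (simp_all add: mult_ac)
    show ?thesis using assms(2) unfolding theta_def unisum_term_def 1 2 by (simp add: field_simps)
  qed
  then show ?thesis
    using sums_divide[OF summable_sums[OF summable_unisum_term[OF assms(1), of x]], of "theta x q"]
    by (simp add: unisum_def)
qed

lemma gmock_unisum:
  assumes "norm q < 1" "theta x q \<noteq> 0"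
  shows "gmock x q = (unisum x q / theta x q - 1) / x"
  using sums_unique[OF universal_series_sums[OF assms]]
  by (simp add: gmock_def divide_inverse mult.commute)

lemma rank_series_sums:
  assumes "norm q < 1" "theta z q \<noteq> 0" "z \<noteq> 1"
  shows "(\<lambda>n. q ^ n\<^sup>2 / (qpoch (q * z) q n * qpoch (q / z) q n))
    sums ((1 - z) * unisum z q / theta z q)"
  using sums_mult[OF universal_series_sums[OF assms(1,2)], of "1 - z"] assms(3)
  by (simp add: qpoch_Suc')

text \<open>A closed annulus whose radii have ratio \<open>1 / norm q\<close> is a compact
  fundamental domain for z -> qz. The maximum of the norm on it is a maximum on the whole open
  annulus, so the maximum modulus principle applies. Periodicity is asked only where both
  \<open>z\<close> and \<open>q * z\<close> lie in the annulus.\<close>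

lemma annulus_periodic_constant:
  fixes q :: complex
  assumes q: "0 < norm q" "norm q < 1"
    and hol: "g holomorphic_on {z. norm q < norm z \<and> norm z < 1 / norm q}" (is "_ holomorphic_on ?A")
    and per: "\<And>z. 1 < norm z \<Longrightarrow> norm z < 1 / norm q \<Longrightarrow> g (q * z) = g z"
  shows "g constant_on ?A"
proof -
  \<comment> \<open>With the radii \<open>r\<close> and \<open>1 / r\<close> the fundamental domain
    lies strictly inside the annulus.\<close>
  define r where "r = sqrt (norm q)"
  have r: "0 < r" "r < 1" "norm q < r" "r * r = norm q"
    using q by (auto simp: r_def real_less_rsqrt power2_eq_square)
  define K where "K = {z :: complex. r \<le> norm z \<and> norm z \<le> 1 / r}"
  have "r * r < r * 1" using r by (intro mult_strict_left_mono) auto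
  have KA: "K \<subseteq> ?A"
  proof
    fix z assume "z \<in> K"
    moreover have "1 / r < 1 / norm q" by (rule divide_strict_left_mono[OF r(3) zero_less_one mult_pos_pos[OF r(1) q(1)]])
    ultimately show "z \<in> ?A" using r by (auto simp: K_def)
  qed
  have "K = cball 0 (1 / r) \<inter> - ball 0 r" by (auto simp: K_def)
  then have "compact K" by (simp add: compact_Int_closed closed_Compl)
  moreover have "1 \<in> K" using r by (auto simp: K_def field_simps)
  moreover have "continuous_on K (\<lambda>z. norm (g z))"
    using holomorphic_on_imp_continuous_on[OF hol] KA
    by (intro continuous_on_norm) (rule continuous_on_subset)
  ultimately obtain m where m: "m \<in> K" "\<And>z. z \<in> K \<Longrightarrow> norm (g z) \<le> norm (g m)"
    using continuous_attains_sup[of K "\<lambda>z. norm (g z)"] by blast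
  have max: "norm (g z) \<le> norm (g m)" if z: "z \<in> ?A" for z
  proof (cases "z \<in> K")
    case False
    consider "norm z < r" | "norm z > 1 / r" using False by (auto simp: K_def)
    then show ?thesis
    proof cases
      case 1
      have "norm (z / q) > 1" "norm (z / q) < 1 / norm q"
        using z q 1 r by (auto simp: norm_divide field_simps)
      moreover have "norm (z / q) \<le> 1 / r"
        using 1 r(1) by (simp add: norm_divide r(4)[symmetric] field_simps)
      moreover have "norm (z / q) \<ge> r" using \<open>norm (z / q) > 1\<close> r by linarith
      ultimately show ?thesis
        using per[of "z / q"] m(2)[of "z / q"] q by (auto simp: K_def)
    next
      case 2
      have "1 < 1 / r" using r by simp
      then have "g (q * z) = g z" using per[of z] z 2 by auto
      moreover have "r * (r * norm z) > r * 1"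
        using 2 r by (intro mult_strict_left_mono) (auto simp: field_simps)
      then have "norm (q * z) \<ge> r"
        by (simp add: norm_mult r(4)[symmetric] mult.assoc)
      moreover have "norm (q * z) < 1" using z q by (simp add: norm_mult field_simps)
      then have "norm (q * z) \<le> 1 / r" using \<open>1 < 1 / r\<close> by linarith
      ultimately show ?thesis using m(2)[of "q * z"] by (auto simp: K_def)
    qed
  qed (use m in auto)
  have "open ?A" by (intro open_Collect_conj open_Collect_less continuous_intros)
  moreover have "connected ?A"
    using connected_annulus(1)[of "norm q" "0 :: complex" "1 / norm q"] by simp
  ultimately show ?thesis
    using maximum_modulus_principle[OF hol, of ?A m] m(1) KA max by blast
qed

section \<open>The Rogers--Fine identity\<close>

lemma norm_power_less_1: "norm (p :: complex) < 1 \<Longrightarrow> 0 < n \<Longrightarrow> norm (p ^ n) < 1"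
  by (simp add: norm_power power_less_one_iff)

lemma power_mult_divide_neq_1:
  fixes q z :: complex
  assumes "norm q < 1" "norm z = 1"
  shows "q ^ n * (q / z) \<noteq> 1"
proof -
  have "norm (q ^ n * (q / z)) = norm (q ^ Suc n)" using assms by (simp add: norm_mult norm_divide)
  also have "\<dots> < 1" using assms by (intro norm_power_less_1) auto
  finally show ?thesis by auto
qed

lemma qpoch_nonzero:
  assumes "\<And>n. q ^ n * x \<noteq> 1"
  shows "qpoch x q n \<noteq> 0"
  using assms by (auto simp: qpoch_def)

lemma inverse_qpoch_bounded:
  assumes "norm q < 1" "\<And>n. q ^ n * x \<noteq> 1"
  obtains K where "\<And>n. norm (inverse (qpoch x q n)) \<le> K" "K > 0"
proof -
  have "qpoch_inf x q \<noteq> 0" using assms by (simp add: qpoch_inf_eq_0_iff)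
  then have "(\<lambda>n. inverse (qpoch x q n)) \<longlonglongrightarrow> inverse (qpoch_inf x q)"
    by (intro tendsto_inverse qpoch_tendsto assms)
  then have "Bseq (\<lambda>n. inverse (qpoch x q n))"
    by (intro convergent_imp_Bseq convergentI)
  then show ?thesis using that unfolding Bseq_def by auto
qed

text \<open>The Rogers-Fine identity with the numerator parameter set to 0. Repeated use of a
  first-order recurrence for the tails \<open>S n\<close> splits off the terms of the fast series
  one at a time.\<close>

lemma rogers_fine:
  fixes b t q :: complex
  assumes q: "norm q < 1" and t: "norm t < 1" and bt: "norm (b * t) \<le> 1"
    and nz: "\<And>n. q ^ n * (q * b) \<noteq> 1"
  shows "(\<lambda>n. (b * t) ^ n * q ^ n\<^sup>2 / (qpoch (q * b) q n * qpoch t q (Suc n)))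
    sums (\<Sum>n. t ^ n / qpoch (q * b) q n)"
proof -
  define d where "d k = inverse (qpoch (q * b) q k)" for k
  obtain K where K: "\<And>n. norm (d n) \<le> K" "K > 0"
    using inverse_qpoch_bounded[OF q nz] unfolding d_def by blast
  have tq: "norm (t * q ^ n) \<le> norm t" for n
    using q by (simp add: norm_mult norm_power mult_left_le power_le_one)
  have "q ^ n * t \<noteq> 1" for n
    using tq[of n] t by (auto simp: mult.commute)
  then obtain K' where K': "\<And>n. norm (inverse (qpoch t q n)) \<le> K'" "K' > 0"
    using inverse_qpoch_bounded[OF q] by blast
  have bound: "norm ((t * q ^ n) ^ m * d k) \<le> norm t ^ m * K" for n m k
    unfolding norm_mult[of _ "d k"] norm_power[of "t * q ^ n"]
    using tq K by (intro mult_mono power_mono) auto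
  have sumK: "summable (\<lambda>m. norm t ^ m * K)"
    using t by (intro summable_mult2 summable_geometric) simp
  have summ: "summable (\<lambda>m. (t * q ^ n) ^ m * d (k m))" for n k
    by (rule summable_comparison_test'[OF sumK, of 0]) (rule bound)
  define S where "S n = (\<Sum>m. (t * q ^ n) ^ m * d (n + m))" for n
  \<comment> \<open>the remainder after \<open>n\<close> terms of the claimed series\<close>
  define G where "G n = (b * t) ^ n * q ^ n\<^sup>2 * inverse (qpoch t q n) * S n" for n
  have S_bound: "norm (S n) \<le> K / (1 - norm t)" for n
  proof -
    have "norm (S n) \<le> (\<Sum>m. norm t ^ m * K)"
      unfolding S_def by (intro norm_suminf_le bound sumK)
    also have "\<dots> = K / (1 - norm t)"
      using t by (subst suminf_mult2[symmetric]) (simp_all add: suminf_geometric summable_geometric)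
    finally show ?thesis .
  qed
  have dd: "d (Suc k) - d k = b * q ^ Suc k * d (Suc k)" for k
  proof -
    have "1 - q ^ k * (q * b) \<noteq> 0" "qpoch (q * b) q k \<noteq> 0"
      using nz[of k] qpoch_nonzero[OF nz] by auto
    then show ?thesis by (simp add: d_def qpoch_Suc field_simps)
  qed
  \<comment> \<open>Multiplication by 1 - u, with u = t q^n, takes differences of neighbouring
    coefficients. By \<open>dd\<close> each difference brings a power of \<open>q\<close> that grows
    with \<open>m\<close>, which changes t q^n into t q^(n+1).\<close>
  have rec: "(1 - t * q ^ n) * S n = d n + b * (t * q ^ n) * q ^ Suc n * S (Suc n)" for n
  proof -
    define u where "u = t * q ^ n"
    have su: "summable (\<lambda>m. u ^ m * d (k m))" for k
      unfolding u_def by (rule summ)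
    have "S n = d n + (\<Sum>m. u ^ Suc m * d (n + Suc m))"
      using suminf_split_head[OF su, of "\<lambda>m. n + m"] by (simp add: S_def u_def)
    moreover have "u * S n = (\<Sum>m. u ^ Suc m * d (n + m))"
      using suminf_mult[OF su, of u "\<lambda>m. n + m"] by (simp add: S_def u_def mult.assoc)
    ultimately have "(1 - u) * S n =
        d n + ((\<Sum>m. u ^ Suc m * d (n + Suc m)) - (\<Sum>m. u ^ Suc m * d (n + m)))"
      by (simp add: algebra_simps)
    also have "(\<Sum>m. u ^ Suc m * d (n + Suc m)) - (\<Sum>m. u ^ Suc m * d (n + m)) =
        (\<Sum>m. u ^ Suc m * d (n + Suc m) - u ^ Suc m * d (n + m))"
      using summable_mult[OF su, of u "\<lambda>m. n + Suc m"] summable_mult[OF su, of u "\<lambda>m. n + m"]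
      by (intro suminf_diff) (simp_all add: mult.assoc)
    also have "(\<lambda>m. u ^ Suc m * d (n + Suc m) - u ^ Suc m * d (n + m)) =
        (\<lambda>m. b * u * q ^ Suc n * ((t * q ^ Suc n) ^ m * d (Suc n + m)))"
    proof
      fix m
      have "u ^ Suc m * d (n + Suc m) - u ^ Suc m * d (n + m) = u ^ Suc m * (d (Suc (n + m)) - d (n + m))"
        by (simp add: algebra_simps)
      also have "\<dots> = b * u * q ^ Suc n * ((u * q) ^ m * d (Suc n + m))"
        unfolding dd by (simp add: power_add power_mult_distrib mult_ac)
      finally show "u ^ Suc m * d (n + Suc m) - u ^ Suc m * d (n + m) =
          b * u * q ^ Suc n * ((t * q ^ Suc n) ^ m * d (Suc n + m))"
        by (simp add: u_def mult_ac)
    qed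
    also have "(\<Sum>m. b * u * q ^ Suc n * ((t * q ^ Suc n) ^ m * d (Suc n + m))) =
        b * u * q ^ Suc n * S (Suc n)"
      unfolding S_def by (rule suminf_mult[OF summ])
    finally show ?thesis by (simp add: u_def)
  qed
  have diff: "G n - G (Suc n) = (b * t) ^ n * q ^ n\<^sup>2 / (qpoch (q * b) q n * qpoch t q (Suc n))" for n
  proof -
    define u where "u = t * q ^ n"
    have "norm u < 1" using tq[of n] t by (simp add: u_def)
    then have u: "1 - u \<noteq> 0" by auto
    have inv: "inverse (qpoch t q n) = (1 - u) * inverse (qpoch t q (Suc n))"
      using u by (simp add: qpoch_Suc u_def mult.commute)
    have sq: "q ^ (Suc n)\<^sup>2 = q ^ n\<^sup>2 * q ^ n * q ^ Suc n"
      by (simp add: power2_eq_square power_add mult_ac)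
    have "G n = (b * t) ^ n * q ^ n\<^sup>2 * inverse (qpoch t q (Suc n)) * ((1 - u) * S n)"
      unfolding G_def inv by (simp only: mult_ac)
    moreover have "G (Suc n) = (b * t) ^ n * q ^ n\<^sup>2 * inverse (qpoch t q (Suc n)) *
        (b * u * q ^ Suc n * S (Suc n))"
      unfolding G_def sq by (simp add: u_def mult_ac)
    moreover have "(1 - u) * S n = d n + b * u * q ^ Suc n * S (Suc n)"
      using rec[of n] by (simp add: u_def)
    ultimately have "G n - G (Suc n) = (b * t) ^ n * q ^ n\<^sup>2 * inverse (qpoch t q (Suc n)) * d n"
      by (simp only: distrib_left add_diff_cancel_right')
    then show ?thesis by (simp add: d_def field_simps)
  qed
  have "G \<longlonglongrightarrow> 0"
  proof (rule Lim_null_comparison)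
    have "norm (G n) \<le> norm q ^ n * K' * (K / (1 - norm t))" for n
    proof -
      have "norm (G n) = norm (b * t) ^ n * norm q ^ n\<^sup>2 * norm (inverse (qpoch t q n)) * norm (S n)"
        by (simp add: G_def norm_mult norm_power)
      also have "\<dots> \<le> 1 * norm q ^ n * K' * (K / (1 - norm t))"
        using bt t K K' by (intro mult_mono S_bound norm_power_square_le q power_le_one) auto
      finally show ?thesis by simp
    qed
    then show "\<forall>\<^sub>F n in sequentially. norm (G n) \<le> norm q ^ n * K' * (K / (1 - norm t))" by simp
    show "(\<lambda>n. norm q ^ n * K' * (K / (1 - norm t))) \<longlonglongrightarrow> 0"
      using q by (intro tendsto_mult_left_zero LIMSEQ_power_zero) auto
  qed
  from telescope_sums'[OF this] have "(\<lambda>n. G n - G (Suc n)) sums G 0" by simp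
  moreover have "G 0 = (\<Sum>n. t ^ n / qpoch (q * b) q n)"
    by (simp add: G_def S_def d_def divide_inverse)
  ultimately show ?thesis unfolding diff by simp
qed

text \<open>Rogers-Fine with b = q/z and t = qz. Then bt = q^2, and (bt)^n q^(n^2) is q^((n+1)^2 -
  1), so multiplication by q / (1 - q/z) produces the rank series without its term n = 0. On the
  right, \<open>Suc L\<close> will be the largest part of a partition.\<close>

lemma rank_series_largest_part:
  fixes z q :: complex
  assumes q: "norm q < 1" and z: "z \<noteq> 0" "norm (q * z) < 1" and nz: "\<And>n. q ^ n * (q / z) \<noteq> 1"
  shows "(\<lambda>n. q ^ n\<^sup>2 / (qpoch (q * z) q n * qpoch (q / z) q n))
    sums (1 + (\<Sum>L. z ^ L * q ^ Suc L / qpoch (q / z) q (Suc L)))"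
proof -
  have nz': "q ^ n * (q * (q / z)) \<noteq> 1" for n
    using nz[of "Suc n"] by (simp add: mult_ac)
  have bt: "q / z * (q * z) = q\<^sup>2" using z by (simp add: power2_eq_square)
  have "norm (q\<^sup>2) \<le> 1" using q by (simp add: norm_power power_le_one)
  then have *: "(\<lambda>n. (q\<^sup>2) ^ n * q ^ n\<^sup>2 / (qpoch (q * (q / z)) q n * qpoch (q * z) q (Suc n)))
      sums (\<Sum>n. (q * z) ^ n / qpoch (q * (q / z)) q n)"
    using rogers_fine[OF q z(2), of "q / z"] nz' unfolding bt by blast
  have sq: "q ^ (Suc n)\<^sup>2 = q * ((q\<^sup>2) ^ n * q ^ n\<^sup>2)" for n
    by (simp add: power2_eq_square power_add power_mult_distrib mult_ac)
  have nz0: "1 - q / z \<noteq> 0" using nz[of 0] by simp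
  have "(\<lambda>n. q ^ (Suc n)\<^sup>2 / (qpoch (q * z) q (Suc n) * qpoch (q / z) q (Suc n)))
      sums (q / (1 - q / z) * (\<Sum>n. (q * z) ^ n / qpoch (q * (q / z)) q n))"
    using sums_mult[OF *, of "q / (1 - q / z)"]
    unfolding sq qpoch_Suc'[of "q / z"] by (simp add: mult_ac)
  from sums_Suc[of "\<lambda>n. q ^ n\<^sup>2 / (qpoch (q * z) q n * qpoch (q / z) q n)", OF this]
  have "(\<lambda>n. q ^ n\<^sup>2 / (qpoch (q * z) q n * qpoch (q / z) q n))
      sums (q / (1 - q / z) * (\<Sum>n. (q * z) ^ n / qpoch (q * (q / z)) q n) + 1)" by simp
  moreover have "q / (1 - q / z) * (\<Sum>n. (q * z) ^ n / qpoch (q * (q / z)) q n) =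
      (\<Sum>L. z ^ L * q ^ Suc L / qpoch (q / z) q (Suc L))"
  proof -
    obtain K where K: "\<And>n. norm (inverse (qpoch (q * (q / z)) q n)) \<le> K" "K > 0"
      using inverse_qpoch_bounded[OF q nz'] by blast
    have "summable (\<lambda>n. norm (q * z) ^ n * K)"
      using z by (intro summable_mult2 summable_geometric) simp
    moreover have "norm ((q * z) ^ n / qpoch (q * (q / z)) q n) \<le> norm (q * z) ^ n * K" for n
      unfolding divide_inverse[of "_ ^ _"] norm_mult[of "_ ^ _"] norm_power
      by (intro mult_left_mono K) simp
    ultimately have "summable (\<lambda>n. (q * z) ^ n / qpoch (q * (q / z)) q n)"
      by (rule summable_comparison_test'[of _ 0])
    from suminf_mult[OF this, of "q / (1 - q / z)"] show ?thesis
      by (simp add: qpoch_Suc' power_mult_distrib mult_ac)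
  qed
  ultimately show ?thesis by (simp add: add.commute)
qed

text \<open>At z = 1 the sum over largest parts telescopes, which gives the Durfee square identity:
  the sum of q^(n^2) / (q)_n^2 is 1 / (q)_inf. This is the value needed to fix the constant in
  \<open>unisum_odd_part\<close>.\<close>

lemma unisum_1:
  assumes q: "norm q < 1"
  shows "unisum 1 q = qpoch_inf q q"
proof -
  have nz: "q ^ n * q \<noteq> 1" for n
    using power_mult_divide_neq_1[OF q, of 1 n] by simp
  have E: "qpoch_inf q q \<noteq> 0" using qpoch_inf_nonzero[OF q q] .
  have "1 / qpoch q q (Suc L) - 1 / qpoch q q L = 1 ^ L * q ^ Suc L / qpoch (q / 1) q (Suc L)" for L
  proof -
    have "1 - q ^ L * q \<noteq> 0" "qpoch q q L \<noteq> 0" using nz[of L] qpoch_nonzero[OF nz] by auto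
    then show ?thesis by (simp add: qpoch_Suc field_simps)
  qed
  moreover have "(\<lambda>L. 1 / qpoch q q (Suc L) - 1 / qpoch q q L) sums (1 / qpoch_inf q q - 1 / qpoch q q 0)"
    by (intro telescope_sums tendsto_intros qpoch_tendsto q E)
  ultimately have "(\<Sum>L. 1 ^ L * q ^ Suc L / qpoch (q / 1) q (Suc L)) = 1 / qpoch_inf q q - 1"
    by (simp add: sums_iff)
  then have *: "(\<lambda>n. q ^ n\<^sup>2 / (qpoch q q n * qpoch q q n)) sums (1 / qpoch_inf q q)"
    using rank_series_largest_part[OF q, of 1] nz q by simp
  have "qpoch_inf q q = qpoch q q n * qpoch_inf (q ^ Suc n) q" for n
    using qpoch_inf_split[OF q, of q n] by (simp add: mult.commute)
  then have "qpoch_inf (q ^ Suc n) q = qpoch_inf q q / qpoch q q n" for n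
    using qpoch_nonzero[OF nz] by (simp add: field_simps)
  then have "unisum_term 1 q = (\<lambda>n. (qpoch_inf q q)\<^sup>2 * (q ^ n\<^sup>2 / (qpoch q q n * qpoch q q n)))"
    by (simp add: unisum_term_def fun_eq_iff power2_eq_square)
  then have "unisum_term 1 q sums ((qpoch_inf q q)\<^sup>2 * (1 / qpoch_inf q q))"
    using sums_mult[OF *] by simp
  then show ?thesis using E by (simp add: unisum_def sums_iff power2_eq_square)
qed

section \<open>Theta identities\<close>

text \<open>
  Dividing by \<open>theta z q * theta (- z) q * theta (- (q * z\<^sup>2)) (q ^ 4)\<close> turns this into the formula for the
  odd part of $P(z;q)$; in the multiplied form there are no poles.
\<close>

lemma unisum_odd_part:
  fixes q z :: complex
  assumes q: "0 < norm q" "norm q < 1"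
    and z: "norm (q\<^sup>2) < norm z" "norm z < 1 / norm (q\<^sup>2)"
  shows "(unisum z q * theta (- z) q - unisum (- z) q * theta z q) / 2 * theta (- (q * z\<^sup>2)) (q ^ 4)
      - (unisum (- (q * z\<^sup>2)) (q ^ 4) - theta (- (q * z\<^sup>2)) (q ^ 4)) * (theta z q * theta (- z) q) / z
    = qpoch_inf q q * theta (- 1) q * theta (- q) (q ^ 4) / 2 * z"
proof -
  define L where "L z = (unisum z q * theta (- z) q - unisum (- z) q * theta z q) / 2 * theta (- (q * z\<^sup>2)) (q ^ 4)
      - (unisum (- (q * z\<^sup>2)) (q ^ 4) - theta (- (q * z\<^sup>2)) (q ^ 4)) * (theta z q * theta (- z) q) / z" for z
  define A where "A = {z :: complex. norm (q\<^sup>2) < norm z \<and> norm z < 1 / norm (q\<^sup>2)}"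
  have q0: "q \<noteq> 0" using q by auto
  have q2: "0 < norm (q\<^sup>2)" "norm (q\<^sup>2) < 1" and q4: "norm (q ^ 4) < 1" "q ^ 4 \<noteq> 0"
    using q q0 by (auto simp: norm_power power_less_one_iff)
  have A0: "x \<noteq> 0" if "x \<in> A" for x using that by (auto simp: A_def)
  \<comment> \<open>The period is \<open>q\<^sup>2\<close> and not \<open>q\<close>, because a
    single shift by \<open>q\<close> exchanges odd and even parts.\<close>
  have "(\<lambda>z. L z / z) constant_on A"
    unfolding A_def
  proof (rule annulus_periodic_constant[OF q2])
    show "(\<lambda>z. L z / z) holomorphic_on {z. norm (q\<^sup>2) < norm z \<and> norm z < 1 / norm (q\<^sup>2)}"
      unfolding L_def A_def[symmetric]
      by (intro holomorphic_intros q q4) (use A0 q0 in auto)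
    fix z :: complex assume "1 < norm z"
    then have z: "z \<noteq> 0" by auto
    have th: "theta (q\<^sup>2 * x) q = theta x q / (q * x\<^sup>2)" if "x \<noteq> 0" for x
      using theta_shift[OF q(2) q0, of "q * x"] theta_shift[OF q(2) q0, of x] that q0
      by (simp add: power2_eq_square mult.assoc)
    have un: "unisum (q\<^sup>2 * x) q = q ^ 3 * x\<^sup>2 * (q * x\<^sup>2 * unisum x q - (1 - q * x\<^sup>2) / x * theta x q)
        + (1 - q ^ 3 * x\<^sup>2) / (q * x\<^sup>2) * theta x q" if "x \<noteq> 0" for x
      using unisum_shift[OF q(2) q0, of "q * x"] unisum_shift[OF q(2) q0, of x]
        theta_shift[OF q(2) q0, of x] that q0
      by (simp add: power2_eq_square power3_eq_cube mult_ac)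
    \<comment> \<open>A double step in base \<open>q\<close> is exactly one step for
      \<open>w\<close> in base \<open>q ^ 4\<close>.\<close>
    define w where "w = - (q * z\<^sup>2)"
    have w: "- (q * (q\<^sup>2 * z)\<^sup>2) = q ^ 4 * w"
      by (simp add: w_def power_mult_distrib flip: power_mult)
    have w0: "w \<noteq> 0" using z q0 by (simp add: w_def)
    define U T U' T' V R where "U = unisum z q" and "T = theta z q"
      and "U' = unisum (- z) q" and "T' = theta (- z) q"
      and "V = unisum w (q ^ 4)" and "R = theta w (q ^ 4)"
    have "L (q\<^sup>2 * z) = ((q ^ 3 * z\<^sup>2 * (q * z\<^sup>2 * U - (1 - q * z\<^sup>2) / z * T)
          + (1 - q ^ 3 * z\<^sup>2) / (q * z\<^sup>2) * T) * (T' / (q * z\<^sup>2))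
          - (q ^ 3 * z\<^sup>2 * (q * z\<^sup>2 * U' + (1 - q * z\<^sup>2) / z * T')
          + (1 - q ^ 3 * z\<^sup>2) / (q * z\<^sup>2) * T') * (T / (q * z\<^sup>2))) / 2 * (- R / w)
        - (q ^ 4 * w\<^sup>2 * V - (1 - q ^ 4 * w\<^sup>2) / w * R + R / w) * ((T / (q * z\<^sup>2)) * (T' / (q * z\<^sup>2))) / (q\<^sup>2 * z)"
      using th[of z] th[of "- z"] un[of z] un[of "- z"] z
        theta_shift[OF q4 w0] unisum_shift[OF q4 w0]
      unfolding L_def w by (simp add: U_def T_def U'_def T'_def V_def R_def)
    also have "\<dots> = q\<^sup>2 * ((U * T' - U' * T) / 2 * R - (V - R) * (T * T') / z)"
      using z q0 unfolding w_def
      by (simp add: divide_simps) (simp add: algebra_simps eval_nat_numeral)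
    finally have "L (q\<^sup>2 * z) = q\<^sup>2 * L z"
      by (simp add: L_def U_def T_def U'_def T'_def V_def R_def w_def)
    then show "L (q\<^sup>2 * z) / (q\<^sup>2 * z) = L z / z" using q0 by simp
  qed
  moreover have "1 \<in> A" using q2 by (auto simp: A_def)
  moreover have "z \<in> A" using z by (simp add: A_def)
  ultimately have "L z / z = L 1 / 1" unfolding constant_on_def by metis
  then have "L z = L 1 * z" using A0[of z] z by (simp add: A_def field_simps)
  \<comment> \<open>Since \<open>theta 1 q = 0\<close>, the only term of \<open>L 1\<close> that
    survives is the one containing \<open>unisum 1 q\<close>.\<close>
  then show ?thesis unfolding L_def by (simp add: q unisum_1)
qed

lemma holomorphic_remove_zero:
  assumes "f holomorphic_on A" "open A" "a \<in> A" "f a = 0"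
  obtains g where "g holomorphic_on A" "\<And>x. x \<in> A \<Longrightarrow> f x = (x - a) * g x"
proof
  show "(\<lambda>x. if x = a then deriv f a else (f x - f a) / (x - a)) holomorphic_on A"
    using assms by (intro pole_lemma) (auto simp: interior_open)
qed (use assms in auto)

text \<open>The quotient F / theta is invariant under x -> px. In the annulus theta has only the
  simple zero 1, which F shares, so the quotient extends holomorphically and is constant.\<close>

lemma theta_unique:
  fixes p :: complex
  assumes p: "0 < norm p" "norm p < 1"
    and hol: "F holomorphic_on - {0}" and F1: "F 1 = 0"
    and shift: "\<And>x. x \<noteq> 0 \<Longrightarrow> F (p * x) = - F x / x"
  obtains c where "\<And>x. norm p < norm x \<Longrightarrow> norm x * norm p < 1 \<Longrightarrow> F x = c * theta x p"
proof -
  define A where "A = {x :: complex. norm p < norm x \<and> norm x < 1 / norm p}"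
  have A0: "x \<noteq> 0" and Ap: "norm x * norm p < 1" "norm p < norm x" if "x \<in> A" for x
    using that p by (auto simp: A_def field_simps)
  have p0: "p \<noteq> 0" using p by auto
  have "open A" unfolding A_def by (intro open_Collect_conj open_Collect_less continuous_intros)
  moreover have "1 \<in> A" using p by (auto simp: A_def)
  moreover have "F holomorphic_on A" by (rule holomorphic_on_subset[OF hol]) (use A0 in auto)
  ultimately obtain g where g: "g holomorphic_on A" "\<And>x. x \<in> A \<Longrightarrow> F x = (x - 1) * g x"
    using holomorphic_remove_zero[of F A 1] F1 by blast
  define D where "D x = qpoch_inf (p * x) p * qpoch_inf (p / x) p" for x
  have D0: "D x \<noteq> 0" if "x \<in> A" for x
  proof -
    have "norm (p * x) < 1" "norm (p / x) < 1"
      using that p Ap[OF that] A0[OF that] by (auto simp: norm_mult norm_divide mult.commute)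
    then show ?thesis unfolding D_def by (simp add: qpoch_inf_nonzero p)
  qed
  have theta_D: "theta x p = (1 - x) * D x" for x
    using qpoch_inf_rec[OF p(2), of x] by (simp add: theta_def D_def)
  define H where "H x = - g x / D x" for x
  have FH: "F x = H x * theta x p" if "x \<in> A" for x
    using g(2)[OF that] D0[OF that] by (simp add: H_def theta_D) (simp add: algebra_simps)
  have "H constant_on A"
    unfolding A_def
  proof (rule annulus_periodic_constant[OF p])
    show "H holomorphic_on {x. norm p < norm x \<and> norm x < 1 / norm p}"
      unfolding H_def A_def[symmetric]
    proof (intro holomorphic_intros g)
      show "D holomorphic_on A" unfolding D_def by (intro holomorphic_intros p) (use A0 in auto)
    qed (use D0 in auto)
    fix x :: complex assume x: "1 < norm x" "norm x < 1 / norm p"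
    have "norm p * 1 < norm p * norm x" using x p by (intro mult_strict_left_mono) auto
    moreover have px: "norm p * norm x < 1" using x p by (simp add: field_simps)
    moreover have "norm p * norm x * norm p < 1 * 1"
      using px p by (intro mult_strict_mono) auto
    then have "norm p * norm x < 1 / norm p" using p by (simp add: pos_less_divide_eq)
    moreover have "norm p < norm x" using x p by linarith
    ultimately have xA: "x \<in> A" "p * x \<in> A"
      using x(2) unfolding A_def by (simp_all only: norm_mult mult_1_right mem_Collect_eq simp_thms)
    have x0: "x \<noteq> 0" using x by auto
    \<comment> \<open>Invariance is tested only for \<open>1 < norm x\<close>, away from the zero at
      1, so \<open>H\<close> can be recovered by dividing by theta.\<close>
    have nz: "theta x p \<noteq> 0" using x Ap[OF xA(1)] p by (intro theta_nonzero) auto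
    have "H (p * x) * theta (p * x) p = - (H x * theta x p) / x"
      using shift[OF x0] FH[OF xA(1)] FH[OF xA(2)] by simp
    then show "H (p * x) = H x"
      using nz x0 unfolding theta_shift[OF p(2) p0 x0] by (simp add: field_simps)
  qed
  then obtain c where "\<And>x. x \<in> A \<Longrightarrow> H x = c" unfolding constant_on_def by blast
  then have "F x = c * theta x p" if "norm p < norm x" "norm x * norm p < 1" for x
    using FH[of x] that p by (auto simp: A_def field_simps)
  then show ?thesis by (rule that)
qed

section \<open>Special theta values as quotients of the products (p^k;p^k)_inf\<close>

lemma qpoch_inf_self_nonzero: "norm p < 1 \<Longrightarrow> qpoch_inf p p \<noteq> 0"
  by (simp add: qpoch_inf_nonzero)

lemma qpoch_inf_odd:
  assumes "norm p < 1"
  shows "qpoch_inf p (p\<^sup>2) * qpoch_inf (p\<^sup>2) (p\<^sup>2) = qpoch_inf p p"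
  using qpoch_inf_square_base[OF assms, of p] by (simp add: power2_eq_square)

lemma theta_minus_1:
  assumes "norm p < 1"
  shows "theta (- 1) p * (qpoch_inf p p)\<^sup>2 = 2 * (qpoch_inf (p\<^sup>2) (p\<^sup>2))\<^sup>2"
proof -
  have "theta (- 1) p = 2 * (qpoch_inf (- p) p)\<^sup>2"
    using qpoch_inf_rec[OF assms, of "- 1"] by (simp add: theta_def power2_eq_square)
  then show ?thesis
    by (simp add: power_mult_distrib mult_ac flip: qpoch_inf_mult_minus[OF assms, of p])
qed

text \<open>The point \<open>p\<close> is fixed by the reflection x -> p^2/x, so theta is the square
  of (p;p^2)_inf, the product over odd exponents.\<close>

lemma theta_half_base:
  assumes "norm p < 1"
  shows "theta p (p\<^sup>2) * (qpoch_inf (p\<^sup>2) (p\<^sup>2))\<^sup>2 = (qpoch_inf p p)\<^sup>2"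
  by (cases "p = 0")
     (simp_all add: theta_def power2_eq_square mult_ac flip: qpoch_inf_odd[OF assms])

text \<open>The two factors in base p^4 start at -p and -p^3 and together run over all odd
  exponents.\<close>

lemma theta_minus_quarter_base:
  assumes "norm p < 1"
  shows "theta (- p) (p ^ 4) = qpoch_inf (- p) (p\<^sup>2)"
proof (cases "p = 0")
  case False
  have "p ^ 4 / - p = - (p ^ 3)" "p\<^sup>2 * - p = - (p ^ 3)" "(p\<^sup>2)\<^sup>2 = p ^ 4"
    using False by (simp_all add: eval_nat_numeral)
  then show ?thesis
    using qpoch_inf_square_base[OF norm_power_less_1[OF assms, of 2], of "- p"]
    by (simp add: theta_def)
qed (simp add: theta_def)

text \<open>The products (p;p^2)_inf and (-p;p^2)_inf combine to (p^2;p^4)_inf, and the factor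
  (p^4;p^4)_inf completes this to (p^2;p^2)_inf. The second copy of (p^2;p^2)_inf is the even half
  of (p)_inf.\<close>

lemma qpoch_inf_minus_odd:
  assumes "norm p < 1"
  shows "qpoch_inf (- p) (p\<^sup>2) * qpoch_inf p p * qpoch_inf (p ^ 4) (p ^ 4) = (qpoch_inf (p\<^sup>2) (p\<^sup>2))\<^sup>2"
proof -
  have p2: "norm (p\<^sup>2) < 1" using assms by (rule norm_power_less_1) simp
  have [simp]: "(p\<^sup>2)\<^sup>2 = p ^ 4" by simp
  have "qpoch_inf p (p\<^sup>2) * qpoch_inf (- p) (p\<^sup>2) = qpoch_inf (p\<^sup>2) (p ^ 4)"
    using qpoch_inf_mult_minus[OF p2, of p] by simp
  moreover have "qpoch_inf (p\<^sup>2) (p ^ 4) * qpoch_inf (p ^ 4) (p ^ 4) = qpoch_inf (p\<^sup>2) (p\<^sup>2)"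
    using qpoch_inf_odd[OF p2] by simp
  moreover have "qpoch_inf (- p) (p\<^sup>2) * qpoch_inf p p * qpoch_inf (p ^ 4) (p ^ 4) =
      qpoch_inf p (p\<^sup>2) * qpoch_inf (- p) (p\<^sup>2) * qpoch_inf (p ^ 4) (p ^ 4) * qpoch_inf (p\<^sup>2) (p\<^sup>2)"
    unfolding qpoch_inf_odd[OF assms, symmetric] by (simp only: mult_ac)
  ultimately show ?thesis by (simp only: power2_eq_square[of "qpoch_inf _ _"])
qed

text \<open>The four factors in base p^8 start at -p, -p^3, -p^5 and -p^7, which exhausts the odd
  exponents.\<close>

lemma theta_minus_eighth_base:
  assumes "norm p < 1"
  shows "theta (- p) (p ^ 8) * theta (- (p ^ 3)) (p ^ 8) = qpoch_inf (- p) (p\<^sup>2)"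
proof (cases "p = 0")
  case False
  have p2: "norm (p\<^sup>2) < 1" and p4: "norm (p ^ 4) < 1"
    using norm_power_less_1[OF assms] by auto
  have sq: "(p\<^sup>2)\<^sup>2 = p ^ 4" "(p ^ 4)\<^sup>2 = p ^ 8" by simp_all
  have "p ^ 8 / - p = p ^ 4 * - (p ^ 3)" "p ^ 8 / - (p ^ 3) = p ^ 4 * - p" "p\<^sup>2 * - p = - (p ^ 3)"
    using False by (simp_all add: eval_nat_numeral)
  then have "theta (- p) (p ^ 8) * theta (- (p ^ 3)) (p ^ 8) =
      (qpoch_inf (- p) (p ^ 8) * qpoch_inf (p ^ 4 * - p) (p ^ 8)) *
      (qpoch_inf (p\<^sup>2 * - p) (p ^ 8) * qpoch_inf (p ^ 4 * (p\<^sup>2 * - p)) (p ^ 8))"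
    by (simp only: theta_def mult_ac)
  also have "\<dots> = qpoch_inf (- p) (p ^ 4) * qpoch_inf (p\<^sup>2 * - p) (p ^ 4)"
    using qpoch_inf_square_base[OF p4, unfolded sq] by (simp only:)
  also have "\<dots> = qpoch_inf (- p) (p\<^sup>2)"
    using qpoch_inf_square_base[OF p2, unfolded sq] by (simp only:)
  finally show ?thesis .
qed (simp add: theta_def)

section \<open>Two-term dissection and sum of squares\<close>

text \<open>In the series for j(x;p) this is the splitting by the parity of the index. Here the
  right-hand side is shown to have the quasi-period of theta and the zero 1, so
  \<open>theta_unique\<close> leaves one constant. The square root \<open>s\<close> of
  \<open>p\<close> is needed to name a point \<open>y\<close> with p y^2 = -1.\<close>

lemma theta_dissection:
  fixes s p x :: complex
  assumes s: "0 < norm s" "norm s < 1" and p: "p = s\<^sup>2"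
    and x: "norm p < norm x" "norm x * norm p < 1"
  shows "qpoch_inf p p * theta x p =
    qpoch_inf (p ^ 4) (p ^ 4) * (theta (- (p * x\<^sup>2)) (p ^ 4) - x * theta (- (p ^ 3 * x\<^sup>2)) (p ^ 4))"
proof -
  define F where "F x = theta (- (p * x\<^sup>2)) (p ^ 4) - x * theta (- (p ^ 3 * x\<^sup>2)) (p ^ 4)" for x
  have s0: "s \<noteq> 0" and p0: "p \<noteq> 0" using s p by auto
  have np: "0 < norm p" "norm p < 1" using p0 norm_power_less_1[OF s(2), of 2] by (simp_all add: p)
  have p4: "norm (p ^ 4) < 1" "p ^ 4 \<noteq> 0" using norm_power_less_1[OF np(2), of 4] p0 by auto
  obtain c where c: "\<And>x. norm p < norm x \<Longrightarrow> norm x * norm p < 1 \<Longrightarrow> F x = c * theta x p"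
  proof (rule theta_unique[OF np])
    show "F holomorphic_on - {0}"
      unfolding F_def by (intro holomorphic_intros p4) (use p0 in auto)
    have "p ^ 4 / - p = - (p ^ 3)" using p0 by (simp add: eval_nat_numeral)
    then show "F 1 = 0"
      using theta_reflect[OF p4(2), of "- p"] p0 by (simp add: F_def)
    fix x :: complex assume x: "x \<noteq> 0"
    have "- (p * (p * x)\<^sup>2) = - (p ^ 3 * x\<^sup>2)" "- (p ^ 3 * (p * x)\<^sup>2) = p ^ 4 * - (p * x\<^sup>2)"
      by (simp_all add: eval_nat_numeral)
    then have "F (p * x) = theta (- (p ^ 3 * x\<^sup>2)) (p ^ 4) - p * x * (theta (- (p * x\<^sup>2)) (p ^ 4) / (p * x\<^sup>2))"
      using theta_shift[OF p4, of "- (p * x\<^sup>2)"] x p0 unfolding F_def by simp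
    then show "F (p * x) = - F x / x"
      using x p0 by (simp add: F_def field_simps power2_eq_square)
  qed (use that in blast)
  \<comment> \<open>the constant is read off at \<open>y\<close>, where the first summand of \<open>F\<close> vanishes\<close>
  define y where "y = \<i> / s"
  have "p * y\<^sup>2 = - 1" "p ^ 3 * y\<^sup>2 = - (p\<^sup>2)"
    using s0 by (simp_all add: y_def p power_divide eval_nat_numeral)
  then have Fy: "F y = - y * theta (p\<^sup>2) (p ^ 4)" using p4 by (simp add: F_def)
  have ny: "norm y = 1 / norm s" by (simp add: y_def norm_divide)
  then have "1 < norm y" using s by simp
  then have "norm p < norm y" using np(2) by linarith
  moreover have "norm y * norm p < 1" using s by (simp add: ny p norm_mult power2_eq_square)
  ultimately have "F y = c * theta y p" by (rule c)
  moreover have "theta y p = - y * qpoch_inf (- p) (p\<^sup>2)"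
  proof -
    \<comment> \<open>Up to a shift by \<open>p\<close>, the reflection of \<open>y\<close> is
      \<open>u\<close>. As u^2 = -p, the two factors of \<open>theta u p\<close> start at u and -u
      and combine to (-p;p^2)_inf.\<close>
    define u where "u = - (\<i> * s)"
    have u: "u \<noteq> 0" "p / y = p * u" "p / u = - u" "u\<^sup>2 = - p" "1 / u = y"
      using s0 by (auto simp: u_def y_def p power2_eq_square field_simps)
    have "theta y p = theta (p / y) p"
      using p0 s0 by (intro theta_reflect[symmetric]) (auto simp: y_def)
    also have "\<dots> = - (1 / u) * theta u p"
      using theta_shift[OF np(2) p0 u(1)] by (simp add: u(2))
    also have "theta u p = qpoch_inf (- p) (p\<^sup>2)"
      using qpoch_inf_mult_minus[OF np(2), of u] by (simp add: theta_def u(3,4))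
    finally show ?thesis by (simp add: u(5))
  qed
  ultimately have "- y * theta (p\<^sup>2) (p ^ 4) = c * (- y * qpoch_inf (- p) (p\<^sup>2))" using Fy by simp
  then have c1: "theta (p\<^sup>2) (p ^ 4) = c * qpoch_inf (- p) (p\<^sup>2)" using s0 by (simp add: y_def)
  define e1 e2 e4 where "e1 = qpoch_inf p p" and "e2 = qpoch_inf (p\<^sup>2) (p\<^sup>2)" and "e4 = qpoch_inf (p ^ 4) (p ^ 4)"
  have e: "e1 \<noteq> 0" "e2 \<noteq> 0" "e4 \<noteq> 0"
    unfolding e1_def e2_def e4_def
    by (auto intro!: qpoch_inf_self_nonzero norm_power_less_1 np)
  define B where "B = qpoch_inf (- p) (p\<^sup>2)"
  have 1: "c * B * e4\<^sup>2 = e2\<^sup>2"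
    using theta_half_base[OF norm_power_less_1[OF np(2), of 2]] c1 by (simp add: B_def e2_def e4_def)
  have 2: "B * e1 * e4 = e2\<^sup>2"
    using qpoch_inf_minus_odd[OF np(2)] by (simp add: B_def e1_def e2_def e4_def)
  have "(B * e4) * (c * e4) = c * B * e4\<^sup>2" by (simp add: power2_eq_square)
  also have "\<dots> = (B * e4) * e1" unfolding 1 2[symmetric] by simp
  finally have "c * e4 = e1"
    using 2 e by (subst (asm) mult_cancel_left) auto
  then show ?thesis using c[OF x] by (simp add: F_def e1_def e4_def) (simp add: mult_ac)
qed

text \<open>Both sides acquire the factor x^(-2) under x -> px. In the annulus
  \<open>theta (- (x\<^sup>2)) (p\<^sup>2)\<close> vanishes only at i and -i, and so does the sum of
  squares there, because theta(-i) = i theta(i). After both zeros are divided out the quotient is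
  constant, and x = 1 gives its value because theta(1) = 0.\<close>

lemma theta_square_sum:
  fixes p x :: complex
  assumes p: "0 < norm p" "norm p < 1" and x: "norm p < norm x" "norm x * norm p < 1"
  shows "((theta x p)\<^sup>2 + (theta (- x) p)\<^sup>2) * theta (- 1) (p\<^sup>2) = (theta (- 1) p)\<^sup>2 * theta (- (x\<^sup>2)) (p\<^sup>2)"
proof -
  define A where "A = {x :: complex. norm p < norm x \<and> norm x < 1 / norm p}"
  define F where "F x = (theta x p)\<^sup>2 + (theta (- x) p)\<^sup>2" for x
  have A0: "x \<noteq> 0" and Ap: "norm x * norm p < 1" "norm p < norm x" if "x \<in> A" for x
    using that p by (auto simp: A_def field_simps)
  have p0: "p \<noteq> 0" using p by auto
  have p2: "norm (p\<^sup>2) < 1" "p\<^sup>2 \<noteq> 0" using norm_power_less_1[OF p(2), of 2] p0 by auto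
  have "open A" unfolding A_def by (intro open_Collect_conj open_Collect_less continuous_intros)
  have inA: "\<i> \<in> A" "- \<i> \<in> A" "1 \<in> A" using p by (auto simp: A_def)
  have "F holomorphic_on A" unfolding F_def by (intro holomorphic_intros p) (use A0 in auto)
  moreover have "theta (- \<i>) p = \<i> * theta \<i> p"
    using theta_inverse[OF p(2) p0, of "\<i>"] by (simp add: field_simps)
  then have Fi: "F \<i> = 0" "F (- \<i>) = 0" by (auto simp: F_def power_mult_distrib)
  ultimately obtain g where g: "g holomorphic_on A" "\<And>x. x \<in> A \<Longrightarrow> F x = (x - \<i>) * g x"
    using holomorphic_remove_zero[of F A "\<i>"] \<open>open A\<close> inA by blast
  have "g (- \<i>) = 0" using g(2)[OF inA(2)] Fi by simp
  with g(1) obtain h where h: "h holomorphic_on A" "\<And>x. x \<in> A \<Longrightarrow> g x = (x + \<i>) * h x"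
    using holomorphic_remove_zero[of g A "- \<i>"] \<open>open A\<close> inA by auto
  define D where "D x = qpoch_inf (- ((p * x)\<^sup>2)) (p\<^sup>2) * qpoch_inf (- ((p / x)\<^sup>2)) (p\<^sup>2)" for x
  have D0: "D x \<noteq> 0" if "x \<in> A" for x
  proof -
    have "norm (p * x) < 1" "norm (p / x) < 1"
      using that p Ap[OF that] A0[OF that] by (auto simp: norm_mult norm_divide mult.commute)
    then have "norm ((p * x)\<^sup>2) < 1" "norm ((p / x)\<^sup>2) < 1" by (auto intro: norm_power_less_1)
    then show ?thesis unfolding D_def by (simp add: qpoch_inf_nonzero p2)
  qed
  have theta_D: "theta (- (x\<^sup>2)) (p\<^sup>2) = (1 + x\<^sup>2) * D x" for x
    using qpoch_inf_rec[OF p2(1), of "- (x\<^sup>2)"]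
    by (simp add: theta_def D_def power_mult_distrib power_divide)
  define H where "H x = h x / D x" for x
  have FH: "F x = H x * theta (- (x\<^sup>2)) (p\<^sup>2)" if "x \<in> A" for x
  proof -
    have "(x - \<i>) * (x + \<i>) = 1 + x\<^sup>2" by (simp add: algebra_simps power2_eq_square)
    then have "F x = (1 + x\<^sup>2) * h x" using g(2)[OF that] h(2)[OF that] by (metis mult.assoc)
    then show ?thesis using D0[OF that] by (simp add: H_def theta_D)
  qed
  have "H constant_on A"
    unfolding A_def
  proof (rule annulus_periodic_constant[OF p])
    show "H holomorphic_on {x. norm p < norm x \<and> norm x < 1 / norm p}"
      unfolding H_def A_def[symmetric]
    proof (intro holomorphic_intros h)
      show "D holomorphic_on A" unfolding D_def by (intro holomorphic_intros p2) (use A0 in auto)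
    qed (use D0 in auto)
    fix x :: complex assume x: "1 < norm x" "norm x < 1 / norm p"
    have "norm p * 1 < norm p * norm x" using x p by (intro mult_strict_left_mono) auto
    moreover have px: "norm p * norm x < 1" using x p by (simp add: field_simps)
    moreover have "norm p * norm x * norm p < 1 * 1"
      using px p by (intro mult_strict_mono) auto
    then have "norm p * norm x < 1 / norm p" using p by (simp add: pos_less_divide_eq)
    moreover have "norm p < norm x" using x p by linarith
    ultimately have xA: "x \<in> A" "p * x \<in> A"
      using x(2) unfolding A_def by (simp_all only: norm_mult mult_1_right mem_Collect_eq simp_thms)
    have x0: "x \<noteq> 0" using x by auto
    have "norm (x\<^sup>2) > 1" using x by (simp add: norm_power one_less_power)
    moreover from this have "- (x\<^sup>2) \<noteq> 1" by (metis less_irrefl norm_minus_cancel norm_one)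
    moreover have "(norm p * norm x)\<^sup>2 < 1" using px p by (simp add: power_less_one_iff)
    ultimately have nz: "theta (- (x\<^sup>2)) (p\<^sup>2) \<noteq> 0"
      using p2 by (intro theta_nonzero) (auto simp: norm_mult norm_power power_mult_distrib mult.commute)
    have "F (p * x) = F x / x\<^sup>2"
      using theta_shift[OF p(2) p0, of x] theta_shift[OF p(2) p0, of "- x"] x0
      by (simp add: F_def power_divide add_divide_distrib)
    moreover have "theta (- ((p * x)\<^sup>2)) (p\<^sup>2) = theta (- (x\<^sup>2)) (p\<^sup>2) / x\<^sup>2"
      using theta_shift[OF p2, of "- (x\<^sup>2)"] x0 by (simp add: power_mult_distrib)
    ultimately show "H (p * x) = H x"
      using FH[OF xA(1)] FH[OF xA(2)] nz x0 by (simp add: field_simps)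
  qed
  then obtain c where c: "\<And>x. x \<in> A \<Longrightarrow> H x = c" unfolding constant_on_def by blast
  have "F 1 = c * theta (- 1) (p\<^sup>2)" using FH[OF inA(3)] c[OF inA(3)] by simp
  then have "(theta (- 1) p)\<^sup>2 = c * theta (- 1) (p\<^sup>2)" using p by (simp add: F_def)
  moreover have "x \<in> A" using x p by (auto simp: A_def field_simps)
  then have "F x = c * theta (- (x\<^sup>2)) (p\<^sup>2)" using FH c by simp
  ultimately show ?thesis by (simp add: F_def)
qed

section \<open>Partitions by rank\<close>

definition parts_le :: "nat \<Rightarrow> nat multiset set" where
  "parts_le L = {P. \<forall>x\<in>#P. 0 < x \<and> x \<le> L}"

lemma parts_le_0 [simp]: "parts_le 0 = {{#}}"
proof -
  have "P = {#}" if "P \<in> parts_le 0" for P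
  proof (rule ccontr)
    assume "P \<noteq> {#}"
    then obtain x where "x \<in># P" by (meson multiset_nonemptyE)
    then show False using that by (auto simp: parts_le_def)
  qed
  moreover have "{#} \<in> parts_le 0" by (simp add: parts_le_def)
  ultimately show ?thesis by blast
qed

text \<open>Recording the multiplicity of the largest admissible part separately turns each
  induction step on \<open>L\<close> into one geometric series.\<close>

lemma parts_le_Suc_bij:
  "bij_betw (\<lambda>(P, k). P + replicate_mset k (Suc L)) (parts_le L \<times> UNIV) (parts_le (Suc L))"
proof (rule bij_betw_byWitness[where f' = "\<lambda>P. (filter_mset (\<lambda>x. x \<le> L) P, count P (Suc L))"])
  have "filter_mset (\<lambda>x. x \<le> L) P = P" "count P (Suc L) = 0" if "P \<in> parts_le L" for P
    using that by (auto simp: parts_le_def filter_mset_eq_conv count_eq_zero_iff)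
  moreover have "filter_mset (\<lambda>x. x \<le> L) (replicate_mset k (Suc L)) = {#}" for k
    by (rule multiset_eqI) auto
  ultimately show "\<forall>a\<in>parts_le L \<times> UNIV. (\<lambda>P. (filter_mset (\<lambda>x. x \<le> L) P, count P (Suc L)))
      (case a of (P, k) \<Rightarrow> P + replicate_mset k (Suc L)) = a"
    by auto
  show "\<forall>P\<in>parts_le (Suc L). (case (filter_mset (\<lambda>x. x \<le> L) P, count P (Suc L)) of
      (P, k) \<Rightarrow> P + replicate_mset k (Suc L)) = P"
  proof
    fix P assume P: "P \<in> parts_le (Suc L)"
    show "(case (filter_mset (\<lambda>x. x \<le> L) P, count P (Suc L)) of (P, k) \<Rightarrow> P + replicate_mset k (Suc L)) = P"
    proof (rule multiset_eqI)
      fix x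
      have "x \<le> Suc L" if "x \<in># P" using P that by (auto simp: parts_le_def)
      then have "x \<le> L \<or> x = Suc L \<or> count P x = 0" using not_in_iff le_Suc_eq by metis
      then show "count (case (filter_mset (\<lambda>x. x \<le> L) P, count P (Suc L)) of
          (P, k) \<Rightarrow> P + replicate_mset k (Suc L)) x = count P x"
        by auto
    qed
  qed
qed (auto simp: parts_le_def split: if_splits intro: le_SucI)

lemma has_sum_geometric:
  fixes x :: "'a :: {real_normed_field, banach}"
  assumes "norm x < 1"
  shows "((\<lambda>k. x ^ k) has_sum (1 / (1 - x))) UNIV"
  using assms by (intro norm_summable_imp_has_sum geometric_sums) (simp_all add: norm_power summable_geometric)

text \<open>The nonnegative case comes first: there summability over a product set follows from the
  iterated sums, and the result then dominates the complex weights.\<close>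

lemma parts_le_real_has_sum:
  fixes r :: real
  assumes r: "0 \<le> r" "r < 1"
  shows "((\<lambda>P. r ^ sum_mset P) has_sum (\<Prod>i<L. 1 / (1 - r ^ Suc i))) (parts_le L)"
proof (induction L)
  case 0
  show ?case by (simp add: has_sum_finite_iff)
next
  case (Suc L)
  define f where "f = (\<lambda>(P, k). r ^ sum_mset (P + replicate_mset k (Suc L)))"
  have rL: "norm (r ^ Suc L) < 1" using r by (simp add: power_less_one_iff del: power_Suc)
  have f: "f (P, k) = r ^ sum_mset P * (r ^ Suc L) ^ k" for P k
    by (simp add: f_def power_add mult.commute del: power_Suc flip: power_mult)
  have inner: "((\<lambda>k. f (P, k)) has_sum (r ^ sum_mset P * (1 / (1 - r ^ Suc L)))) UNIV" for P
    unfolding f by (intro has_sum_cmult_right has_sum_geometric rL)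
  have outer: "((\<lambda>P. r ^ sum_mset P * (1 / (1 - r ^ Suc L))) has_sum
      (\<Prod>i<Suc L. 1 / (1 - r ^ Suc i))) (parts_le L)"
    using has_sum_cmult_left[OF Suc.IH, of "1 / (1 - r ^ Suc L)"] by (simp del: power_Suc)
  have "(f has_sum (\<Prod>i<Suc L. 1 / (1 - r ^ Suc i))) (parts_le L \<times> UNIV)"
  proof (rule has_sum_SigmaI[OF inner outer])
    show "f summable_on parts_le L \<times> UNIV"
      by (rule summable_on_SigmaI[OF inner has_sum_imp_summable[OF outer]])
         (use r in \<open>auto simp: f_def\<close>)
  qed
  then show ?case
    using has_sum_reindex_bij_betw[OF parts_le_Suc_bij, of "\<lambda>P. r ^ sum_mset P"]
    by (simp add: f_def case_prod_unfold)
qed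

lemma parts_le_has_sum:
  fixes w q :: complex
  assumes q: "norm q < 1" and w: "norm w \<le> 1"
  shows "((\<lambda>P. w ^ size P * q ^ sum_mset P) has_sum (1 / qpoch (q * w) q L)) (parts_le L)"
proof (induction L)
  case 0
  show ?case by (simp add: has_sum_finite_iff)
next
  case (Suc L)
  define f where "f = (\<lambda>(P, k). w ^ size (P + replicate_mset k (Suc L)) * q ^ sum_mset (P + replicate_mset k (Suc L)))"
  have "norm (w * q ^ Suc L) \<le> 1 * norm q ^ Suc L"
    unfolding norm_mult norm_power using w by (intro mult_right_mono) auto
  also have "\<dots> < 1" using q by (simp add: power_less_one_iff del: power_Suc)
  finally have rL: "norm (w * q ^ Suc L) < 1" .
  have f: "f (P, k) = w ^ size P * q ^ sum_mset P * (w * q ^ Suc L) ^ k" for P k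
    by (simp add: f_def power_add power_mult_distrib mult_ac del: power_Suc flip: power_mult)
  have inner: "((\<lambda>k. f (P, k)) has_sum
      (w ^ size P * q ^ sum_mset P * (1 / (1 - w * q ^ Suc L)))) UNIV" for P
    unfolding f by (intro has_sum_cmult_right has_sum_geometric rL)
  have outer: "((\<lambda>P. w ^ size P * q ^ sum_mset P * (1 / (1 - w * q ^ Suc L))) has_sum
      (1 / qpoch (q * w) q (Suc L))) (parts_le L)"
    using has_sum_cmult_left[OF Suc.IH, of "1 / (1 - w * q ^ Suc L)"] 
    by (simp add: qpoch_Suc mult_ac)
  have "(f has_sum (1 / qpoch (q * w) q (Suc L))) (parts_le L \<times> UNIV)"
  proof (rule has_sum_SigmaI[OF inner outer])
    \<comment> \<open>Summability comes from the majorant with real base \<open>norm q\<close>,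
      since the weight \<open>w\<close> has norm at most 1.\<close>
    have "(\<lambda>P. w ^ size P * q ^ sum_mset P) summable_on parts_le (Suc L)"
    proof (rule abs_summable_summable, rule Infinite_Sum.abs_summable_on_comparison_test')
      show "(\<lambda>P. norm q ^ sum_mset P) summable_on parts_le (Suc L)"
        using has_sum_imp_summable[OF parts_le_real_has_sum] q by simp
      show "norm (w ^ size P * q ^ sum_mset P) \<le> norm q ^ sum_mset P" for P
        using w by (simp add: norm_mult norm_power mult_left_le_one_le power_le_one)
    qed
    then show "f summable_on parts_le L \<times> UNIV"
      using summable_on_reindex_bij_betw[OF parts_le_Suc_bij, of "\<lambda>P. w ^ size P * q ^ sum_mset P"]
      by (simp add: f_def case_prod_unfold)
  qed
  then show ?case
    using has_sum_reindex_bij_betw[OF parts_le_Suc_bij, of "\<lambda>P. w ^ size P * q ^ sum_mset P"]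
    by (simp add: f_def case_prod_unfold)
qed

section \<open>All partitions, sorted by largest part\<close>

definition all_parts :: "nat multiset set" where
  "all_parts = {P. \<forall>x\<in>#P. 0 < x}"

lemma all_parts_bij:
  "bij_betw (\<lambda>(L, P). add_mset (Suc L) P) (SIGMA L:UNIV. parts_le (Suc L)) (all_parts - {{#}})"
proof (rule bij_betw_imageI)
  have Max: "Max_mset (add_mset (Suc L) P) = Suc L" if "P \<in> parts_le (Suc L)" for L P
    using that by (intro Max_eqI) (auto simp: parts_le_def)
  show "inj_on (\<lambda>(L, P). add_mset (Suc L) P) (SIGMA L:UNIV. parts_le (Suc L))"
  proof (rule inj_onI, clarify)
    fix L P L' P'
    assume P: "P \<in> parts_le (Suc L)" "P' \<in> parts_le (Suc L')"
      and eq: "add_mset (Suc L) P = add_mset (Suc L') P'"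
    have "Suc L = Suc L'" using Max[OF P(1)] Max[OF P(2)] eq by simp
    then show "L = L' \<and> P = P'" using eq by simp
  qed
  show "(\<lambda>(L, P). add_mset (Suc L) P) ` (SIGMA L:UNIV. parts_le (Suc L)) = all_parts - {{#}}"
  proof (intro equalityI subsetI)
    fix P assume P: "P \<in> all_parts - {{#}}"
    then have "Max_mset P \<in># P" by (intro Max_in) auto
    moreover from this have "0 < Max_mset P" using P by (auto simp: all_parts_def)
    ultimately obtain L P' where L: "Max_mset P = Suc L" "P = add_mset (Suc L) P'"
      by (metis gr0_implies_Suc multi_member_split)
    have "x \<le> Suc L" if "x \<in># P'" for x
      unfolding L(1)[symmetric] using that by (intro Max_ge) (auto simp: L(2))
    then have "P' \<in> parts_le (Suc L)" using P L by (auto simp: parts_le_def all_parts_def)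
    then show "P \<in> (\<lambda>(L, P). add_mset (Suc L) P) ` (SIGMA L:UNIV. parts_le (Suc L))"
      using L by force
  qed (auto simp: all_parts_def parts_le_def)
qed

text \<open>The largest part counts among the parts, so it cancels the 1 in \<open>Suc L\<close>;
  this is why the generating function carries \<open>z ^ L\<close>.\<close>

lemma prank_add_Max:
  assumes "P \<in> parts_le (Suc L)"
  shows "prank (add_mset (Suc L) P) = int L - int (size P)"
proof -
  have "Max_mset (add_mset (Suc L) P) = Suc L"
    using assms by (intro Max_eqI) (auto simp: parts_le_def)
  then show ?thesis by (simp add: prank_def)
qed

text \<open>Sorting by largest part leaves the terms r^(L+1) G(L+1), and G stays bounded because
  (r;r)_n has a nonzero limit.\<close>

lemma all_parts_real_summable:
  fixes r :: real
  assumes r: "0 \<le> r" "r < 1"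
  shows "(\<lambda>P. r ^ sum_mset P) summable_on all_parts"
proof -
  define G where "G L = (\<Prod>i<L. 1 / (1 - r ^ Suc i))" for L
  have nr: "norm (complex_of_real r) < 1" using r by simp
  have "complex_of_real r ^ n * complex_of_real r \<noteq> 1" for n
    using norm_power_less_1[OF nr, of "Suc n"] by (auto simp: mult.commute)
  then obtain K where K: "\<And>n. norm (inverse (qpoch (complex_of_real r) (of_real r) n)) \<le> K" "K > 0"
    using inverse_qpoch_bounded[OF nr] by blast
  have "complex_of_real (G n) = inverse (qpoch (complex_of_real r) (of_real r) n)" for n
    by (simp add: G_def qpoch_def prod_dividef inverse_eq_divide mult.commute)
  then have GK: "\<bar>G n\<bar> \<le> K" for n using K(1)[of n] by (metis norm_of_real)
  have inner: "((\<lambda>P. (\<lambda>(L, P). r ^ sum_mset (add_mset (Suc L) P)) (L, P)) has_sum (r ^ Suc L * G (Suc L)))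
      (parts_le (Suc L))" for L
    using has_sum_cmult_right[OF parts_le_real_has_sum[OF r, of "Suc L"], of "r ^ Suc L"]
    by (simp add: G_def power_add mult_ac)
  have "(\<lambda>(L, P). r ^ sum_mset (add_mset (Suc L) P)) summable_on (SIGMA L:UNIV. parts_le (Suc L))"
  proof (rule summable_on_SigmaI[OF inner])
    have "(\<lambda>L. norm (r ^ Suc L * G (Suc L))) summable_on UNIV"
    proof (rule Infinite_Sum.abs_summable_on_comparison_test')
      show "(\<lambda>L. r ^ L * K) summable_on UNIV"
        using has_sum_geometric[of r] r by (intro summable_on_cmult_left) (auto simp: summable_on_def)
      show "norm (r ^ Suc L * G (Suc L)) \<le> r ^ L * K" for L
        unfolding norm_mult using r GK[of "Suc L"]
        by (intro mult_mono) (auto simp: mult_left_le_one_le)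
    qed
    then show "(\<lambda>L. r ^ Suc L * G (Suc L)) summable_on UNIV" by (rule abs_summable_summable)
  qed (use r in auto)
  then have "(\<lambda>P. r ^ sum_mset P) summable_on (all_parts - {{#}})"
    using summable_on_reindex_bij_betw[OF all_parts_bij, of "\<lambda>P. r ^ sum_mset P"]
    by (simp add: case_prod_unfold)
  moreover have "all_parts = insert {#} (all_parts - {{#}})" by (auto simp: all_parts_def)
  ultimately show ?thesis by (metis summable_on_insert_iff)
qed

text \<open>On the unit circle the power of \<open>z\<close> has norm 1, so the sum converges
  absolutely with majorant \<open>norm q ^ sum_mset P\<close>. It may therefore be evaluated by
  first summing over the partitions with a given largest part.\<close>

lemma rank_generating_function:
  fixes z q :: complex
  assumes q: "norm q < 1" and z: "norm z = 1"
  shows "((\<lambda>P. z powi prank P * q ^ sum_mset P) has_sum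
    (1 + (\<Sum>L. z ^ L * q ^ Suc L / qpoch (q / z) q (Suc L)))) all_parts"
proof -
  have z0: "z \<noteq> 0" using z by auto
  define f where "f P = z powi prank P * q ^ sum_mset P" for P
  have "norm (f P) \<le> norm q ^ sum_mset P" for P
    using z by (simp add: f_def norm_mult norm_power norm_power_int)
  moreover have "(\<lambda>P. norm q ^ sum_mset P) summable_on all_parts"
    using q by (intro all_parts_real_summable) auto
  ultimately have "(\<lambda>P. norm (f P)) summable_on all_parts"
    by (intro Infinite_Sum.abs_summable_on_comparison_test') auto
  then have summ: "f summable_on all_parts" by (rule abs_summable_summable)
  have "q ^ n * (q / z) \<noteq> 1" for n
    by (rule power_mult_divide_neq_1[OF q z])
  then obtain K where K: "\<And>n. norm (inverse (qpoch (q / z) q n)) \<le> K" "K > 0"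
    using inverse_qpoch_bounded[OF q] by blast
  define g where "g L = z ^ L * q ^ Suc L / qpoch (q / z) q (Suc L)" for L
  have inner: "((\<lambda>P. (\<lambda>(L, P). f (add_mset (Suc L) P)) (L, P)) has_sum g L) (parts_le (Suc L))" for L
  proof -
    have "((\<lambda>P. z ^ L * q ^ Suc L * ((1 / z) ^ size P * q ^ sum_mset P)) has_sum
        (z ^ L * q ^ Suc L * (1 / qpoch (q * (1 / z)) q (Suc L)))) (parts_le (Suc L))"
      using z by (intro has_sum_cmult_right parts_le_has_sum q) (simp add: norm_divide)
    moreover have "f (add_mset (Suc L) P) = z ^ L * q ^ Suc L * ((1 / z) ^ size P * q ^ sum_mset P)"
      if "P \<in> parts_le (Suc L)" for P
      using z0 by (simp add: f_def prank_add_Max[OF that] power_int_diff power_add power_divide mult_ac)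
    ultimately have "((\<lambda>P. f (add_mset (Suc L) P)) has_sum
        (z ^ L * q ^ Suc L * (1 / qpoch (q * (1 / z)) q (Suc L)))) (parts_le (Suc L))"
      by (simp only: cong: has_sum_cong)
    moreover have "g L = z ^ L * q ^ Suc L * (1 / qpoch (q * (1 / z)) q (Suc L))"
      by (simp add: g_def)
    ultimately show ?thesis by (simp only: prod.case)
  qed
  have "(f has_sum (\<Sum>L. g L)) (all_parts - {{#}})"
  proof -
    have "summable (\<lambda>L. norm (g L))"
    proof (rule summable_comparison_test'[of "\<lambda>L. norm q ^ L * K" 0])
      show "summable (\<lambda>L. norm q ^ L * K)"
        using q by (intro summable_mult2 summable_geometric) simp
      show "norm (norm (g L)) \<le> norm q ^ L * K" for L
      proof -
        have "norm (g L) = norm q ^ Suc L * norm (inverse (qpoch (q / z) q (Suc L)))"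
          using z by (simp only: g_def divide_inverse[of "_ * _"] norm_mult norm_power power_one mult_1_left)
        also have "\<dots> \<le> norm q ^ L * K"
          using q K by (intro mult_mono K(1) power_decreasing) auto
        finally show ?thesis by (simp only: norm_ge_zero abs_of_nonneg real_norm_def)
      qed
    qed
    then have "(g has_sum (\<Sum>L. g L)) UNIV"
      by (intro norm_summable_imp_has_sum summable_sums) (auto intro: summable_norm_cancel)
    moreover have "(\<lambda>(L, P). f (add_mset (Suc L) P)) summable_on (SIGMA L:UNIV. parts_le (Suc L))"
      using summable_on_reindex_bij_betw[OF all_parts_bij, of f]
        summable_on_subset_banach[OF summ, of "all_parts - {{#}}"]
      by (simp add: case_prod_unfold)
    ultimately have "((\<lambda>(L, P). f (add_mset (Suc L) P)) has_sum (\<Sum>L. g L)) (SIGMA L:UNIV. parts_le (Suc L))"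
      by (intro has_sum_SigmaI[OF inner])
    then show ?thesis
      using has_sum_reindex_bij_betw[OF all_parts_bij, of f] by (simp add: case_prod_unfold)
  qed
  then have "(f has_sum (f {#} + (\<Sum>L. g L))) (insert {#} (all_parts - {{#}}))"
    by (intro has_sum_insert) auto
  moreover have "insert {#} (all_parts - {{#}}) = all_parts" by (auto simp: all_parts_def)
  moreover have "f {#} = 1" by (simp add: f_def prank_def)
  ultimately have "(f has_sum (1 + (\<Sum>L. g L))) all_parts" by simp
  then show ?thesis by (simp only: f_def[abs_def] g_def)
qed

section \<open>Regrouping by the number partitioned\<close>

lemma partitions_of_bounds:
  assumes "P \<in> partitions_of n"
  shows "size P \<le> n" "\<And>x. x \<in># P \<Longrightarrow> x \<le> n" "\<bar>prank P\<bar> \<le> int n"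
proof -
  have pos: "\<forall>x\<in>#P. 0 < x" and n: "sum_mset P = n" using assms by (auto simp: partitions_of_def)
  have "size P \<le> sum_mset P" using pos by (induction P) auto
  then show size: "size P \<le> n" using n by simp
  show le: "x \<le> n" if "x \<in># P" for x
    using n that by (metis le_add1 multi_member_split sum_mset.add_mset)
  show "\<bar>prank P\<bar> \<le> int n"
  proof (cases "P = {#}")
    case False
    then have "Max_mset P \<le> n" using le by simp
    moreover have "prank P = int (Max_mset P) - int (size P)" using False by (simp add: prank_def)
    ultimately show ?thesis using size by linarith
  qed (simp add: prank_def)
qed

lemma finite_partitions_of [simp]: "finite (partitions_of n)"
proof (rule finite_subset)
  show "partitions_of n \<subseteq> mset ` {xs. set xs \<subseteq> {..n} \<and> length xs \<le> n}"
  proof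
    fix P assume P: "P \<in> partitions_of n"
    obtain xs where "P = mset xs" using ex_mset by metis
    then show "P \<in> mset ` {xs. set xs \<subseteq> {..n} \<and> length xs \<le> n}"
      using partitions_of_bounds[OF P] by auto
  qed
  show "finite (mset ` {xs. set xs \<subseteq> {..n} \<and> length xs \<le> n})"
    by (intro finite_imageI finite_lists_length_le) simp
qed

text \<open>Restricting the ranks to [-n, n] in \<open>Nmod\<close> loses nothing, because both the
  largest part and the number of parts are at most \<open>n\<close>.\<close>

lemma Nmod_eq_card: "Nmod a M n = card {P \<in> partitions_of n. prank P mod M = a mod M}"
proof -
  have "{P \<in> partitions_of n. prank P mod M = a mod M} =
      (\<Union>m \<in> {m \<in> {- int n .. int n}. m mod M = a mod M}. {P \<in> partitions_of n. prank P = m})"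
    using partitions_of_bounds(3) by (fastforce simp: abs_le_iff)
  also have "card \<dots> = Nmod a M n"
    unfolding Nmod_def Nrank_def
    by (intro card_UN_disjoint) (auto intro: finite_subset[of _ "{- int n..int n}"])
  finally show ?thesis ..
qed

lemma i_powi_mod_4:
  "(\<i> powi m + (- \<i>) powi m) / 2 = of_bool (m mod 4 = 0) - of_bool (m mod 4 = 2)"
proof -
  define r where "r = nat (m mod 4)"
  have m: "m = 4 * (m div 4) + int r" by (simp add: r_def)
  have r: "r < 4" by (simp add: r_def nat_less_iff)
  have "z powi m = z ^ r" if "z ^ 4 = 1" for z :: complex
  proof -
    have "z \<noteq> 0" using that by auto
    then have "z powi m = z powi (4 * (m div 4)) * z ^ r"
      by (subst m) (simp add: power_int_add)
    also have "z powi (4 * (m div 4)) = (z ^ 4) powi (m div 4)"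
      using power_int_mult[of z 4] by simp
    finally show ?thesis using that by simp
  qed
  then have "\<i> powi m + (- \<i>) powi m = \<i> ^ r + (- \<i>) ^ r" by simp
  moreover have "m mod 4 = int r" by (simp add: r_def)
  moreover have "r = 0 \<or> r = 1 \<or> r = 2 \<or> r = 3" using r by auto
  ultimately show ?thesis by (elim disjE) (simp_all add: power3_eq_cube)
qed

lemma Nmod_difference_sums:
  fixes q :: complex
  assumes q: "norm q < 1"
    and R: "\<And>z. z \<in> {\<i>, - \<i>} \<Longrightarrow> 1 + (\<Sum>L. z ^ L * q ^ Suc L / qpoch (q / z) q (Suc L)) = R z"
  shows "(\<lambda>n. of_int (int (Nmod 0 4 n) - int (Nmod 2 4 n)) * q ^ n) sums ((R \<i> + R (- \<i>)) / 2)"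
proof -
  define f where "f P = (\<i> powi prank P + (- \<i>) powi prank P) / 2 * q ^ sum_mset P" for P
  have "((\<lambda>P. \<i> powi prank P * q ^ sum_mset P) has_sum R \<i>) all_parts"
    using rank_generating_function[OF q, of "\<i>"] R[of "\<i>"] by simp
  moreover have "((\<lambda>P. (- \<i>) powi prank P * q ^ sum_mset P) has_sum R (- \<i>)) all_parts"
    using rank_generating_function[OF q, of "- \<i>"] R[of "- \<i>"] by simp
  ultimately have "((\<lambda>P. (\<i> powi prank P * q ^ sum_mset P + (- \<i>) powi prank P * q ^ sum_mset P) * (1 / 2)) has_sum
      (R \<i> + R (- \<i>)) * (1 / 2)) all_parts"
    by (intro has_sum_cmult_left has_sum_add)
  then have "(f has_sum (R \<i> + R (- \<i>)) / 2) all_parts"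
    unfolding f_def by (simp add: distrib_right)
  \<comment> \<open>Each fibre over \<open>n\<close> is finite, so the unordered sum over partitions
    becomes a sum of finite coefficients.\<close>
  moreover have "bij_betw snd (SIGMA n:UNIV. partitions_of n) all_parts"
  proof (rule bij_betw_imageI)
    show "inj_on snd (SIGMA n:UNIV. partitions_of n)"
      by (rule inj_onI, clarify) (simp add: partitions_of_def)
    have "P \<in> snd ` (SIGMA n:UNIV. partitions_of n)" if "P \<in> all_parts" for P
      using that by (intro rev_image_eqI[of "(sum_mset P, P)"]) (auto simp: all_parts_def partitions_of_def)
    then show "snd ` (SIGMA n:UNIV. partitions_of n) = all_parts"
      by (auto simp: all_parts_def partitions_of_def)
  qed
  ultimately have "((\<lambda>x. f (snd x)) has_sum (R \<i> + R (- \<i>)) / 2) (SIGMA n:UNIV. partitions_of n)"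
    using has_sum_reindex_bij_betw by blast
  then have "((\<lambda>n. \<Sum>P\<in>partitions_of n. f P) has_sum (R \<i> + R (- \<i>)) / 2) UNIV"
    by (rule has_sum_Sigma') (auto intro!: has_sum_finite)
  moreover have "(\<Sum>P\<in>partitions_of n. f P) = of_int (int (Nmod 0 4 n) - int (Nmod 2 4 n)) * q ^ n" for n
  proof -
    have "(\<Sum>P\<in>partitions_of n. f P) =
        (\<Sum>P\<in>partitions_of n. (of_bool (prank P mod 4 = 0) - of_bool (prank P mod 4 = 2)) * q ^ n)"
      unfolding f_def i_powi_mod_4 by (intro sum.cong) (auto simp: partitions_of_def)
    also have "\<dots> = ((\<Sum>P\<in>partitions_of n. of_bool (prank P mod 4 = 0)) -
        (\<Sum>P\<in>partitions_of n. of_bool (prank P mod 4 = 2))) * q ^ n"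
      by (simp only: sum_distrib_right flip: sum_subtractf)
    also have "\<dots> = (of_nat (Nmod 0 4 n) - of_nat (Nmod 2 4 n)) * q ^ n"
      by (simp add: Nmod_eq_card sum_of_bool_eq Collect_conj_eq)
    finally show ?thesis by simp
  qed
  ultimately show ?thesis by (simp add: has_sum_imp_sums)
qed

section \<open>Ranks modulo 4\<close>

text \<open>With p = q^m, the three factors of j(p;p^3) start at p, p^2 and p^3 in base p^3, hence
  run over all exponents.\<close>

lemma Jm_qpoch_inf:
  assumes "norm q < 1" "q \<noteq> 0" "m > 0"
  shows "Jm m q = qpoch_inf (q ^ m) (q ^ m)"
proof -
  define p where "p = q ^ m"
  have p: "norm p < 1" "p \<noteq> 0" using norm_power_less_1[OF assms(1,3)] assms(2) by (auto simp: p_def)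
  have "Jm m q = jfun p (p ^ 3)"
    by (simp add: Jm_def Jam_def p_def mult.commute flip: power_mult)
  moreover have "p ^ 3 / p = p ^ 2 * p / p" by (simp add: eval_nat_numeral)
  ultimately show ?thesis
    using qpoch_inf_power_base[OF p(1), of 3 p] p(2)
    by (simp add: jfun_def p_def[symmetric] eval_nat_numeral mult_ac)
qed

lemma rank_series_theta:
  assumes q: "norm q < 1" "q \<noteq> 0" and z: "norm z = 1" "z \<noteq> 1"
  shows "1 + (\<Sum>L. z ^ L * q ^ Suc L / qpoch (q / z) q (Suc L)) = (1 - z) * unisum z q / theta z q"
proof (rule sums_unique2)
  have z0: "z \<noteq> 0" using z by auto
  show "(\<lambda>n. q ^ n\<^sup>2 / (qpoch (q * z) q n * qpoch (q / z) q n))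
      sums (1 + (\<Sum>L. z ^ L * q ^ Suc L / qpoch (q / z) q (Suc L)))"
    using q z z0 by (intro rank_series_largest_part power_mult_divide_neq_1) (auto simp: norm_mult)
  show "(\<lambda>n. q ^ n\<^sup>2 / (qpoch (q * z) q n * qpoch (q / z) q n)) sums ((1 - z) * unisum z q / theta z q)"
    using q z by (intro rank_series_sums theta_nonzero) auto
qed

text \<open>The analytic form of N(m,n) = N(-m,n): \<open>unisum\<close> is symmetric, and 1 - 1/z
  and theta acquire the same factor -1/z.\<close>

lemma rank_series_inverse:
  assumes q: "norm q < 1" "q \<noteq> 0" and z: "norm z = 1" "z \<noteq> 1"
  shows "(1 - 1 / z) * unisum (1 / z) q / theta (1 / z) q = (1 - z) * unisum z q / theta z q"
proof -
  have z0: "z \<noteq> 0" using z by auto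
  have "theta z q \<noteq> 0" using q z by (intro theta_nonzero) auto
  then show ?thesis
    using theta_inverse[OF q z0] z0 by (simp add: unisum_inverse field_simps)
qed

text \<open>The left side collects the constants of three uses of \<open>unisum_odd_part\<close>.
  With h = theta(q^2;q^4), the first quotient is h e4 a^2 / b and the second is h e4 (a^2 + b^2) /
  b. Their difference is -h e4 b, and the dissection rewrites e4 b as e16 (A - q B).\<close>

lemma theta_product_identity:
  fixes q :: complex
  assumes q: "0 < norm q" "norm q < 1"
  defines "a \<equiv> theta (- q) (q ^ 4)" and "b \<equiv> theta q (q ^ 4)"
    and "A \<equiv> theta (- (q ^ 6)) (q ^ 16)" and "B \<equiv> theta (- (q\<^sup>2)) (q ^ 16)"
    and "e4 \<equiv> qpoch_inf (q ^ 4) (q ^ 4)" and "e16 \<equiv> qpoch_inf (q ^ 16) (q ^ 16)"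
    and "\<kappa> \<equiv> qpoch_inf (q ^ 4) (q ^ 4) * theta (- 1) (q ^ 4) * theta (- (q ^ 4)) (q ^ 16) / 2"
  shows "qpoch_inf q q * theta (- 1) q * a / (theta (- 1) (q\<^sup>2) * b) - 2 * \<kappa> * (A + q * B) / (A * B * a * b)
    = - (theta (q\<^sup>2) (q ^ 4) * e16 * (A - q * B))"
proof -
  define e1 e2 e8 where "e1 = qpoch_inf q q" and "e2 = qpoch_inf (q\<^sup>2) (q\<^sup>2)" and "e8 = qpoch_inf (q ^ 8) (q ^ 8)"
  define \<theta>1 \<theta>2 \<theta>4 \<theta>8 where "\<theta>1 = theta (- 1) q" and "\<theta>2 = theta (- 1) (q\<^sup>2)"
    and "\<theta>4 = theta (- 1) (q ^ 4)" and "\<theta>8 = theta (- 1) (q ^ 8)"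
  define h where "h = theta (q\<^sup>2) (q ^ 4)"
  have pw: "(q\<^sup>2)\<^sup>2 = q ^ 4" "(q\<^sup>2) ^ 4 = q ^ 8" "(q ^ 4)\<^sup>2 = q ^ 8" "(q ^ 8)\<^sup>2 = q ^ 16" "(q ^ 4) ^ 4 = q ^ 16"
    "(q\<^sup>2) ^ 8 = q ^ 16" "(q\<^sup>2) ^ 3 = q ^ 6" "(q ^ 4) ^ 3 = q ^ 12"
    by (simp_all flip: power_mult)
  have n: "norm (q ^ k) < 1" if "k > 0" for k using norm_power_less_1[OF q(2) that] .
  have n2: "norm (q\<^sup>2) < 1" and n4: "norm (q ^ 4) < 1" and n8: "norm (q ^ 8) < 1"
    using n by auto
  have q0: "q \<noteq> 0" using q by auto
  have e: "e1 \<noteq> 0" "e2 \<noteq> 0" "e4 \<noteq> 0" "e8 \<noteq> 0" "e16 \<noteq> 0"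
    unfolding e1_def e2_def e4_def e8_def e16_def by (auto intro!: qpoch_inf_self_nonzero n q)
  have \<theta>: "\<theta>1 = 2 * e2\<^sup>2 / e1\<^sup>2" "\<theta>2 = 2 * e4\<^sup>2 / e2\<^sup>2" "\<theta>4 = 2 * e8\<^sup>2 / e4\<^sup>2" "\<theta>8 = 2 * e16\<^sup>2 / e8\<^sup>2"
    using theta_minus_1[OF q(2)] theta_minus_1[OF n2] theta_minus_1[OF n4] theta_minus_1[OF n8] e
    unfolding pw by (simp_all add: \<theta>1_def \<theta>2_def \<theta>4_def \<theta>8_def e1_def e2_def e4_def e8_def e16_def field_simps)
  have h: "h = e2\<^sup>2 / e4\<^sup>2"
    using theta_half_base[OF n2] e unfolding pw by (simp add: h_def e2_def e4_def field_simps)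
  have a: "a = e2\<^sup>2 / (e1 * e4)"
    using theta_minus_quarter_base[OF q(2)] qpoch_inf_minus_odd[OF q(2)] e
    by (simp add: a_def e1_def e2_def e4_def field_simps)
  have odd: "qpoch_inf (- (q\<^sup>2)) (q ^ 4) = e4\<^sup>2 / (e2 * e8)"
    using qpoch_inf_minus_odd[OF n2] e unfolding pw by (simp add: e2_def e4_def e8_def field_simps)
  have t2: "theta (- (q\<^sup>2)) (q ^ 8) = e4\<^sup>2 / (e2 * e8)"
    using theta_minus_quarter_base[OF n2] odd unfolding pw by simp
  have t4: "theta (- (q ^ 4)) (q ^ 16) = e8\<^sup>2 / (e4 * e16)"
    using theta_minus_quarter_base[OF n4] qpoch_inf_minus_odd[OF n4] e
    unfolding pw by (simp add: e4_def e8_def e16_def field_simps)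
  have AB: "A * B = e4\<^sup>2 / (e2 * e8)"
    using theta_minus_eighth_base[OF n2] odd unfolding pw by (simp add: A_def B_def mult.commute)
  have AB0: "A \<noteq> 0" "B \<noteq> 0" "a \<noteq> 0" using AB a e by auto
  have ann: "norm (q ^ 4) < norm q" "norm q * norm (q ^ 4) < 1"
  proof -
    have "norm q ^ 4 < norm q ^ 1" using q by (intro power_strict_decreasing) auto
    then show "norm (q ^ 4) < norm q" by (simp add: norm_power)
    have "norm q * norm (q ^ 4) = norm (q ^ 5)" by (simp add: norm_mult eval_nat_numeral)
    then show "norm q * norm (q ^ 4) < 1" using n[of 5] by simp
  qed
  have b0: "b \<noteq> 0" unfolding b_def using q ann by (intro theta_nonzero n4) auto
  have q16: "norm (q ^ 16) < 1" "q ^ 16 \<noteq> 0" using n q0 by auto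
  have "q ^ 16 / - (q\<^sup>2) = - (q ^ 14)" using q0 by (simp add: eval_nat_numeral)
  then have B': "theta (- (q ^ 14)) (q ^ 16) = B"
    using theta_reflect[OF q16(2), of "- (q\<^sup>2)"] q0 by (simp add: B_def)
  have x2: "q ^ 4 * q\<^sup>2 = q ^ 6" "q ^ 12 * q\<^sup>2 = q ^ 14" by (simp_all flip: power_add)
  \<comment> \<open>The dissection in base q^4 at x = q and x = -q; there p x^2 = q^6 and p^3 x^2 =
    q^14.\<close>
  have b_eq: "e4 * b = e16 * (A - q * B)" and a_eq: "e4 * a = e16 * (A + q * B)"
    using theta_dissection[of "q\<^sup>2" "q ^ 4" q] theta_dissection[of "q\<^sup>2" "q ^ 4" "- q"] q q0 n2 ann
    by (simp_all add: pw x2 B' flip: a_def b_def A_def B_def e4_def e16_def)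
  have sq: "(b\<^sup>2 + a\<^sup>2) * \<theta>8 = \<theta>4\<^sup>2 * theta (- (q\<^sup>2)) (q ^ 8)"
    using theta_square_sum[of "q ^ 4" q] q0 n4 ann unfolding pw
    by (simp add: a_def b_def \<theta>4_def \<theta>8_def)
  have \<kappa>: "2 * \<kappa> = e4 * \<theta>4 * (e8\<^sup>2 / (e4 * e16))"
    unfolding \<kappa>_def t4 by (simp add: e4_def \<theta>4_def)
  have first: "e1 * \<theta>1 / \<theta>2 = h * e4 * a"
    unfolding \<theta> h a using e by (simp add: field_simps power2_eq_square)
  \<comment> \<open>The sum of squares in base q^4 at x = q leads to theta(-q^2;q^8), which has the
    same value as \<open>A * B\<close>.\<close>
  have second: "h * (a\<^sup>2 + b\<^sup>2) * (e16 * (A * B)) = 2 * \<kappa>"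
  proof -
    have ab: "a\<^sup>2 + b\<^sup>2 = \<theta>4\<^sup>2 * (e4\<^sup>2 / (e2 * e8)) / \<theta>8"
      using sq e unfolding t2 \<theta>(4) by (simp add: field_simps)
    show ?thesis
      unfolding ab \<kappa> AB h \<theta> using e by (simp add: field_simps power2_eq_square)
  qed
  have "e1 * \<theta>1 * a / (\<theta>2 * b) = (e1 * \<theta>1 / \<theta>2) * a / b" by simp
  then have "e1 * \<theta>1 * a / (\<theta>2 * b) = h * e4 * a\<^sup>2 / b"
    unfolding first by (simp add: power2_eq_square)
  moreover have "2 * \<kappa> * (A + q * B) / (A * B * a * b) = h * (a\<^sup>2 + b\<^sup>2) * e4 / b"
  proof -
    have "A + q * B = e4 * a / e16" using a_eq e by (simp add: field_simps)
    then show ?thesis unfolding second[symmetric] using AB0 b0 e by simp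
  qed
  moreover have "e16 * (A - q * B) = e4 * b" using b_eq by simp
  ultimately show ?thesis
    using b0 unfolding e1_def[symmetric] \<theta>1_def[symmetric] \<theta>2_def[symmetric] h_def[symmetric]
    by (simp add: mult.assoc) (simp add: field_simps power2_eq_square)
qed

theorem theorem1p2:
  fixes q :: complex
  assumes "0 < norm q" and "norm q < 1"
  shows "(\<Sum>n. (of_int (int (Nmod 0 4 n) - int (Nmod 2 4 n)) :: complex) * q ^ n)
    = 2 - 2 * q\<^sup>2 * gmock (- (q\<^sup>2)) (q ^ 16) + 2 * q ^ 5 * gmock (- (q ^ 6)) (q ^ 16)
      - Jam 2 4 q * Jbar 6 16 q / Jm 4 q + q * (Jam 2 4 q * Jbar 2 16 q / Jm 4 q)"
proof -
  note q = assms
  have q0: "q \<noteq> 0" using q by auto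
  have n: "norm (q ^ k) < 1" if "k > 0" for k using norm_power_less_1[OF q(2) that] .
  have less: "norm q ^ k < norm q ^ m" if "m < k" for k m
    using q that by (intro power_strict_decreasing) auto
  have n4: "norm (q ^ 4) < 1" "q ^ 4 \<noteq> 0" and n16: "norm (q ^ 16) < 1" "q ^ 16 \<noteq> 0"
    using n q0 by auto
  have ann: "norm p < norm (q ^ k) \<and> norm (q ^ k) * norm p < 1" if "p = q ^ m" "k < m" "k > 0" for p k m
    using less[OF that(2)] n[of "k + m"] that by (simp add: norm_power power_add norm_mult)
  have i1: "\<i> \<noteq> 1" "- \<i> \<noteq> (1 :: complex)" by (auto simp: complex_eq_iff)

  define R where "R z = (1 - z) * unisum z q / theta z q" for z
  define \<phi> where "\<phi> = R \<i>"
  have "R (- \<i>) = \<phi>"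
    using rank_series_inverse[OF q(2) q0, of \<i>] i1 by (simp add: R_def \<phi>_def)
  moreover have "1 + (\<Sum>L. z ^ L * q ^ Suc L / qpoch (q / z) q (Suc L)) = R z" if "z \<in> {\<i>, - \<i>}" for z
    unfolding R_def using that i1 by (intro rank_series_theta[OF q(2) q0]) auto
  note Nmod_difference_sums[OF q(2) this]
  ultimately have lhs: "(\<Sum>n. (of_int (int (Nmod 0 4 n) - int (Nmod 2 4 n)) :: complex) * q ^ n) = \<phi>"
    by (simp add: \<phi>_def sums_iff)

  define a b where "a = theta (- q) (q ^ 4)" and "b = theta q (q ^ 4)"
  define A B where "A = theta (- (q ^ 6)) (q ^ 16)" and "B = theta (- (q\<^sup>2)) (q ^ 16)"
  define u u' where "u = unisum q (q ^ 4)" and "u' = unisum (- q) (q ^ 4)"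
  define uA uB where "uA = unisum (- (q ^ 6)) (q ^ 16)" and "uB = unisum (- (q\<^sup>2)) (q ^ 16)"
  define \<tau> where "\<tau> = theta (- 1) (q\<^sup>2)"
  \<comment> \<open>The coefficient of z on the right of \<open>unisum_odd_part\<close> in base q^4;
    \<open>c * a / 2\<close> is its counterpart in base q.\<close>
  define \<kappa> where "\<kappa> = qpoch_inf (q ^ 4) (q ^ 4) * theta (- 1) (q ^ 4) * theta (- (q ^ 4)) (q ^ 16) / 2"
  define e4 e16 where "e4 = qpoch_inf (q ^ 4) (q ^ 4)" and "e16 = qpoch_inf (q ^ 16) (q ^ 16)"
  define c where "c = qpoch_inf q q * theta (- 1) q"
  have n1: "- (q ^ k) \<noteq> 1" "q ^ k \<noteq> 1" if "k > 0" for k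
    using n[OF that] by (auto dest!: arg_cong[of "- _" _ norm])
  have nz: "a \<noteq> 0" "b \<noteq> 0" "A \<noteq> 0" "B \<noteq> 0"
    unfolding a_def b_def A_def B_def
    using ann[of "q ^ 4" 4 1] ann[of "q ^ 16" 16 6] ann[of "q ^ 16" 16 2] n1[of 1] n1[of 6] n1[of 2]
    by (simp_all add: theta_nonzero n4 n16)
  have ti: "theta \<i> q \<noteq> 0" "theta (- \<i>) q \<noteq> 0"
    using q i1 by (simp_all add: theta_nonzero)
  have \<tau>: "theta \<i> q * theta (- \<i>) q = \<tau>"
    using theta_mult_minus[OF q(2), of \<i>] by (simp add: \<tau>_def)
  have \<tau>0: "\<tau> \<noteq> 0" using ti \<tau> by auto

  \<comment> \<open>At z = i the argument -q z^2 equals q. Since P(i) and P(-i) are \<phi> / (1 - i)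
    and \<phi> / (1 + i), the odd part is i \<phi> / 2, so the equation relates \<phi> to u / b =
    P(q;q^4).\<close>
  have I: "\<phi> * b * \<tau> / 2 + (u - b) * \<tau> = c * a / 2"
  proof -
    have i2: "1 - \<i> \<noteq> 0" "1 + \<i> \<noteq> 0" by (auto simp: complex_eq_iff)
    have \<phi>1: "\<phi> = (1 - \<i>) * unisum \<i> q / theta \<i> q" by (simp add: \<phi>_def R_def)
    have \<phi>2: "\<phi> = (1 + \<i>) * unisum (- \<i>) q / theta (- \<i>) q"
      using \<open>R (- \<i>) = \<phi>\<close> by (simp add: R_def)
    have U: "unisum \<i> q = \<phi> * theta \<i> q / (1 - \<i>)" unfolding \<phi>1 using ti i2 by simp
    have U': "unisum (- \<i>) q = \<phi> * theta (- \<i>) q / (1 + \<i>)" unfolding \<phi>2 using ti i2 by simp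
    have "norm (q\<^sup>2) < norm \<i> \<and> norm \<i> < 1 / norm (q\<^sup>2)" using n[of 2] q by (simp add: field_simps)
    then have "(unisum \<i> q * theta (- \<i>) q - unisum (- \<i>) q * theta \<i> q) / 2 * b
        - (u - b) * \<tau> / \<i> = c * a / 2 * \<i>"
      using unisum_odd_part[OF q, of \<i>] by (simp add: b_def u_def a_def c_def \<tau>)
    moreover have "unisum \<i> q * theta (- \<i>) q - unisum (- \<i>) q * theta \<i> q = \<phi> * \<tau> * \<i>"
    proof -
      have "1 / (1 - \<i>) - 1 / (1 + \<i>) = \<i>" by (simp add: complex_eq_iff Re_divide Im_divide)
      then have "\<phi> * \<tau> * \<i> = \<phi> * \<tau> * (1 / (1 - \<i>) - 1 / (1 + \<i>))" by simp
      then show ?thesis unfolding U U' \<tau>[symmetric] by (simp add: algebra_simps)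
    qed
    ultimately have "\<phi> * \<tau> * \<i> / 2 * b - (u - b) * \<tau> / \<i> = c * a / 2 * \<i>" by simp
    then have "(\<phi> * b * \<tau> / 2 + (u - b) * \<tau>) * \<i> = (c * a / 2) * \<i>"
      by (simp add: algebra_simps)
    then show ?thesis by (metis complex_i_not_zero mult_cancel_right)
  qed

  \<comment> \<open>Base q^4 at z = q, where -q^4 z^2 = -q^6: the difference of P(q;q^4) and
    P(-q;q^4), multiplied by \<open>a * b\<close>.\<close>
  have II: "(u * a - u' * b) / 2 * A - (uA - A) * (b * a) / q = \<kappa> * q"
  proof -
    have "norm ((q ^ 4)\<^sup>2) < norm q \<and> norm q < 1 / norm ((q ^ 4)\<^sup>2)"
      using ann[of "q ^ 8" 8 1] q0 by (simp add: field_simps flip: power_mult)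
    moreover have "q ^ 4 * q\<^sup>2 = q ^ 6" "(q ^ 4) ^ 4 = q ^ 16" by (simp_all flip: power_mult power_add)
    ultimately show ?thesis
      using unisum_odd_part[of "q ^ 4" q] n4
      by (simp add: \<kappa>_def a_def b_def A_def u_def u'_def uA_def)
  qed

  \<comment> \<open>Base q^4 at z = q^5 = q^4 q. Shifting back to q flips the relative sign of the
    two terms, so their sum appears in place of the difference.\<close>
  have III: "(u * a + u' * b) / 2 * B + (uB - B) * (a * b) = \<kappa>"
  proof -
    have "norm ((q ^ 4)\<^sup>2) < norm (q ^ 5) \<and> norm (q ^ 5) < 1 / norm ((q ^ 4)\<^sup>2)"
      using ann[of "q ^ 8" 8 5] q0 by (simp add: field_simps flip: power_mult)
    moreover have "q ^ 4 * (q ^ 5)\<^sup>2 = q ^ 14" "(q ^ 4) ^ 4 = q ^ 16" by (simp_all flip: power_mult power_add)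
    ultimately have *: "(unisum (q ^ 5) (q ^ 4) * theta (- (q ^ 5)) (q ^ 4) - unisum (- (q ^ 5)) (q ^ 4) * theta (q ^ 5) (q ^ 4)) / 2
          * theta (- (q ^ 14)) (q ^ 16)
        - (unisum (- (q ^ 14)) (q ^ 16) - theta (- (q ^ 14)) (q ^ 16)) *
          (theta (q ^ 5) (q ^ 4) * theta (- (q ^ 5)) (q ^ 4)) / q ^ 5 = \<kappa> * q ^ 5"
      using unisum_odd_part[of "q ^ 4" "q ^ 5"] n4 by (simp add: \<kappa>_def)
    have q5: "q ^ 4 * q = q ^ 5" "q ^ 4 * - q = - (q ^ 5)" by (simp_all add: eval_nat_numeral)
    have t5: "theta (q ^ 5) (q ^ 4) = - b / q" "theta (- (q ^ 5)) (q ^ 4) = a / q"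
      using theta_shift[OF n4, of q] theta_shift[OF n4, of "- q"] q0 unfolding q5
      by (simp_all add: a_def b_def)
    have u5: "unisum (q ^ 5) (q ^ 4) = q ^ 6 * u - (1 - q ^ 6) / q * b"
      "unisum (- (q ^ 5)) (q ^ 4) = q ^ 6 * u' + (1 - q ^ 6) / q * a"
      using unisum_shift[OF n4, of q] unisum_shift[OF n4, of "- q"] q0 unfolding q5
      by (simp_all add: u_def u'_def a_def b_def flip: power_add)
    \<comment> \<open>The argument is now -q^4 (q^5)^2 = -q^14, which is q^16 times the inverse of
      -q^2. One shift and one inversion therefore return it to -q^2.\<close>
    define w where "w = 1 / - (q\<^sup>2)"
    have w: "w \<noteq> 0" "q ^ 16 * w = - (q ^ 14)" "q ^ 16 * w\<^sup>2 = q ^ 12"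
      using q0 by (simp_all add: w_def power_divide) (simp_all add: eval_nat_numeral)
    have tw: "theta w (q ^ 16) = B / q\<^sup>2" and uw: "unisum w (q ^ 16) = uB"
      using theta_inverse[OF n16, of "- (q\<^sup>2)"] unisum_inverse[of "- (q\<^sup>2)" "q ^ 16"] q0
      by (simp_all add: w_def B_def uB_def)
    have t14: "theta (- (q ^ 14)) (q ^ 16) = B"
      using theta_shift[OF n16 w(1)] q0 unfolding w(2) tw by (simp add: w_def)
    have u14: "unisum (- (q ^ 14)) (q ^ 16) = q ^ 12 * uB + (1 - q ^ 12) * B"
      using unisum_shift[OF n16 w(1)] q0 unfolding w(2,3) tw uw by (simp add: w_def)
    have d1: "unisum (q ^ 5) (q ^ 4) * theta (- (q ^ 5)) (q ^ 4) - unisum (- (q ^ 5)) (q ^ 4) * theta (q ^ 5) (q ^ 4)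
        = q ^ 5 * (u * a + u' * b)"
      unfolding t5 u5 using q0 by (simp add: field_simps) (simp add: algebra_simps eval_nat_numeral)
    have d2: "(unisum (- (q ^ 14)) (q ^ 16) - theta (- (q ^ 14)) (q ^ 16)) *
          (theta (q ^ 5) (q ^ 4) * theta (- (q ^ 5)) (q ^ 4)) / q ^ 5 = - (q ^ 5 * ((uB - B) * (a * b)))"
      unfolding t5 u14 t14 using q0 by (simp add: divide_simps) (simp add: algebra_simps eval_nat_numeral)
    have "q ^ 5 * ((u * a + u' * b) / 2 * B + (uB - B) * (a * b)) = q ^ 5 * \<kappa>"
      using *[unfolded d1, unfolded d2, unfolded t14] by (simp add: algebra_simps)
    then show ?thesis using q0 by simp
  qed

  have s1: "(u * a - u' * b) / 2 = (uA - A) * (b * a) / (q * A) + \<kappa> * q / A"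
    using II nz q0 by (simp add: field_simps)
  have s2: "(u * a + u' * b) / 2 = - ((uB - B) * (a * b) / B) + \<kappa> / B"
    using III nz by (simp add: field_simps)
  \<comment> \<open>Adding the half difference and the half sum removes \<open>u'\<close>, so
    P(-q;q^4) never has to be evaluated.\<close>
  have "u * a = (u * a - u' * b) / 2 + (u * a + u' * b) / 2" by (simp add: field_simps)
  then have "u * a = (uA - A) * (b * a) / (q * A) + \<kappa> * q / A - (uB - B) * (a * b) / B + \<kappa> / B"
    unfolding s1 s2 by simp
  then have "u * a / (a * b) = ((uA - A) * (b * a) / (q * A) + \<kappa> * q / A - (uB - B) * (a * b) / B + \<kappa> / B) / (a * b)"
    by simp
  also have "\<dots> = (uA / A - 1) / q - (uB / B - 1) + \<kappa> * (A + q * B) / (A * B * a * b)"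
    using nz q0 by (simp add: field_simps)
  finally have u: "u / b = (uA / A - 1) / q - (uB / B - 1) + \<kappa> * (A + q * B) / (A * B * a * b)"
    using nz by simp
  have "2 * (\<phi> * b * \<tau> / 2 + (u - b) * \<tau>) = 2 * (c * a / 2)" unfolding I ..
  then have "\<phi> * (\<tau> * b) = 2 * \<tau> * b - 2 * \<tau> * u + c * a" by (simp add: algebra_simps)
  then have "\<phi> = 2 - 2 * (u / b) + c * a / (\<tau> * b)"
    using nz \<tau>0 by (simp add: field_simps)
  also have "\<dots> = 2 + 2 * (uB / B - 1) - 2 * (uA / A - 1) / q
      + (c * a / (\<tau> * b) - 2 * \<kappa> * (A + q * B) / (A * B * a * b))"
    unfolding u by (simp add: field_simps)
  \<comment> \<open>What remains besides the two mock theta terms is purely a theta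
    quotient.\<close>
  also have "c * a / (\<tau> * b) - 2 * \<kappa> * (A + q * B) / (A * B * a * b) =
      - (theta (q\<^sup>2) (q ^ 4) * e16 * (A - q * B))"
    using theta_product_identity[OF q]
    by (simp add: c_def a_def b_def A_def B_def \<tau>_def \<kappa>_def e16_def)
  finally have main: "\<phi> = 2 + 2 * (uB / B - 1) - 2 * (uA / A - 1) / q
      - theta (q\<^sup>2) (q ^ 4) * e16 * (A - q * B)" by simp

  have g: "gmock (- (q\<^sup>2)) (q ^ 16) = (uB / B - 1) / - (q\<^sup>2)" "gmock (- (q ^ 6)) (q ^ 16) = (uA / A - 1) / - (q ^ 6)"
    using gmock_unisum[OF n16(1)] nz by (simp_all add: A_def B_def uA_def uB_def)
  have "e4 \<noteq> 0" unfolding e4_def by (intro qpoch_inf_self_nonzero n4)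
  moreover have "Jam 2 4 q = theta (q\<^sup>2) (q ^ 4) * e4" "Jm 4 q = e4"
    "Jbar 6 16 q = A * e16" "Jbar 2 16 q = B * e16"
    using Jm_qpoch_inf[OF q(2) q0, of 4]
    by (simp_all add: Jam_def Jbar_def jfun_theta A_def B_def e4_def e16_def)
  moreover have "2 * q ^ 5 * ((uA / A - 1) / - (q ^ 6)) = - (2 * (uA / A - 1) / q)"
    using q0 by (simp add: divide_simps) (simp add: eval_nat_numeral)
  moreover have "2 * q\<^sup>2 * ((uB / B - 1) / - (q\<^sup>2)) = - 2 * (uB / B - 1)" using q0 by simp
  ultimately show ?thesis unfolding lhs main g by (simp add: algebra_simps)
qed

end
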